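(* Let $N$ be a Riemann surface and $F\colon N\to \mathbb{Q}^4_c$ a conformal immersion. The property of $F$, equipped with its induced metric, being isotropically isothermic is invariant under conformal changes of the metric of $\mathbb{Q}^4_c$. That is, for every smooth positive function $\mu$ on $\mathbb{Q}^4_c$, the isometric immersion $F\colon (N,F^*\langle\cdot,\cdot\rangle)\to(\mathbb{Q}^4_c,\langle\cdot,\cdot\rangle)$ is isotropically isothermic if and only if the isometric immersion $F\colon (N,F^*(\mu^2\langle\cdot,\cdot\rangle))\to(\mathbb{Q}^4_c,\mu^2\langle\cdot,\cdot\rangle)$ is isotropically isothermic.
   Context: $(\mathbb{Q}^4_c,\langle\cdot,\cdot\rangle)$ is the complete simply-connected oriented 4-dimensional Riemannian manifold of constant sectional curvature $c$; all conformally changed metrics are considered with the same orientation. **Definition in space forms.** Let $f\colon M\to\mathbb{Q}^4_c$ be an isometric immersion of an oriented 2-dimensional Riemannian manifold, with normal bundle $N_fM$, normal connection $\nabla^\perp$, second fundamental form $\alpha$, $H=\frac12\mathrm{trace}\,\alpha$, Gaussian curvature $K$, normal curvature $K_N=\langle R^\perp(e_1,e_2)e_4,e_3\rangle$ (positively oriented orthonormal frames), and $J^\perp$ the rotation by $+\pi/2$ in $N_fM$. $M_0^\pm(f)=\{p:\|H\|^2-(K-c)=|K_N|,\ \pm K_N\ge0\}$. For a positively oriented local orthonormal frame $\{e_1,e_2\}$ off $M_0^\pm(f)$, with $\alpha_{kl}=\alpha(e_k,e_l)$, the field $\frac{\alpha_{11}-\alpha_{22}}2\pm J^\perp\alpha_{12}$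 is nowhere zero; let $e_3^\pm$ be its normalization, $e_4^\pm=J^\perp e_3^\pm$, $\omega_{12}=\langle\nabla e_1,e_2\rangle$, $\omega_{34}^\pm=\langle\nabla^\perp e_3^\pm,e_4^\pm\rangle$; the form $\Omega^\pm=2\omega_{12}\pm\omega_{34}^\pm$ is independent of the frame. $f$ is $\pm$ isotropically isothermic if $M_0^\pm(f)=\emptyset$ and $d\star\Omega^\pm=0$ ($\star$ the Hodge star), and isotropically isothermic if this holds for at least one sign. **Definition in general oriented Riemannian 4-manifolds.** Let $f$ be an isometric immersion of an oriented surface $M$ into an oriented Riemannian 4-manifold. In a complex chart $(U,z)$ let $\phi^\pm=\frac12\big(\alpha(\partial_z,\partial_z)\pm iJ^\perp\alpha(\partial_z,\partial_z)\big)$ ($\alpha$ extended $\mathbb{C}$-bilinearly), a section of $N^\pm_fU=\{\xi\in N_fU\otimes\mathbb{C}: J^\perp\xi=\mp i\xi\}$. $f$ is $\pm$ isotropically isothermic if $\phi^\pm$ is nowhere zero and for every simply-connected complex chart $(U,z)$ one has $\phi^\pm=D^\pm\xi^\pm$ with $D^\pm\colon U\to(0,+\infty)$ smooth and $\xi^\pm$ a nowhere-vanishing section of $N_f^\pm U$ that is holomorphic, i.e. $\nabla^\perp_{\partial_{\bar z}}\xi^\pm=0$. $f$ is isotropically isothermic if this holds for at least one sign. For surfaces in space forms this agrees with the definition above. *)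

theory Defs
  imports "HOL-Analysis.Analysis"
begin

section \<open>Smooth functions, charts and atlases\<close>

(* On an open set S of a Euclidean space, Ck_on k f S says that f is k times continuously
   differentiable: every directional derivative of f is C^(k-1). *)
primrec Ck_on :: "nat \<Rightarrow> ('a::euclidean_space \<Rightarrow> 'b::real_normed_vector) \<Rightarrow> 'a set \<Rightarrow> bool" where
  "Ck_on 0 f S \<longleftrightarrow> continuous_on S f"
| "Ck_on (Suc k) f S \<longleftrightarrow>
     (\<forall>x\<in>S. f differentiable (at x)) \<and> (\<forall>v. Ck_on k (\<lambda>x. frechet_derivative f (at x) v) S)"

definition smooth_on :: "'a::euclidean_space set \<Rightarrow> ('a \<Rightarrow> 'b::real_normed_vector) \<Rightarrow> bool" where
  "smooth_on S f \<longleftrightarrow> (\<forall>k. Ck_on k f S)"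

(* Manifolds are carried by whole topological types. A chart is a homeomorphism from an open set
   onto an open set of the model space; the values of the coordinate map off its domain are
   irrelevant. *)
datatype ('m, 'e) chart = Chart (chart_dom: "'m set") (coord: "'m \<Rightarrow> 'e")

definition chart_inv :: "('m, 'e) chart \<Rightarrow> 'e \<Rightarrow> 'm" where
  "chart_inv a = inv_into (chart_dom a) (coord a)"

definition is_chart :: "('m::topological_space, 'e::euclidean_space) chart \<Rightarrow> bool" where
  "is_chart a \<longleftrightarrow> open (chart_dom a) \<and> open (coord a ` chart_dom a) \<and>
     homeomorphism (chart_dom a) (coord a ` chart_dom a) (coord a) (chart_inv a)"

definition overlap :: "('m, 'e) chart \<Rightarrow> ('m, 'd) chart \<Rightarrow> 'e set" where
  "overlap a b = coord a ` (chart_dom a \<inter> chart_dom b)"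

definition transition :: "('m, 'e) chart \<Rightarrow> ('m, 'd) chart \<Rightarrow> 'e \<Rightarrow> 'd" where
  "transition a b = coord b \<circ> chart_inv a"

(* Differential at p of the change of coordinates from a to b. *)
definition jac :: "('m, 'e::euclidean_space) chart \<Rightarrow> ('m, 'e) chart \<Rightarrow> 'm \<Rightarrow> 'e \<Rightarrow> 'e" where
  "jac a b p = frechet_derivative (transition a b) (at (coord a p))"

definition smooth_atlas :: "('m::topological_space, 'e::euclidean_space) chart set \<Rightarrow> bool" where
  "smooth_atlas A \<longleftrightarrow> (\<forall>a\<in>A. is_chart a) \<and> (\<Union>a\<in>A. chart_dom a) = UNIV \<and>
     (\<forall>a\<in>A. \<forall>b\<in>A. smooth_on (overlap a b) (transition a b))"

definition oriented_atlas :: "('m::topological_space, real^'k) chart set \<Rightarrow> bool" where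
  "oriented_atlas B \<longleftrightarrow> smooth_atlas B \<and>
     (\<forall>a\<in>B. \<forall>b\<in>B. \<forall>p \<in> chart_dom a \<inter> chart_dom b. det (matrix (jac a b p)) > 0)"

(* Holomorphic atlas; connectedness is not required. *)
definition riemann_surface :: "('n::topological_space, complex) chart set \<Rightarrow> bool" where
  "riemann_surface A \<longleftrightarrow> (\<forall>a\<in>A. is_chart a) \<and> (\<Union>a\<in>A. chart_dom a) = UNIV \<and>
     (\<forall>a\<in>A. \<forall>b\<in>A. transition a b holomorphic_on overlap a b)"

definition smooth_function ::
    "('m::topological_space, 'e::euclidean_space) chart set \<Rightarrow> ('m \<Rightarrow> real) \<Rightarrow> bool" where
  "smooth_function A u \<longleftrightarrow> (\<forall>a\<in>A. smooth_on (coord a ` chart_dom a) (u \<circ> chart_inv a))"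


section \<open>Riemannian metrics, curvature, space forms\<close>

(* A tangent vector is given by its components in each chart, so g a p is the bilinear form that the
   metric at p induces on the model space through the chart a. *)
type_synonym ('m, 'e) metric_field = "('m, 'e) chart \<Rightarrow> 'm \<Rightarrow> 'e \<Rightarrow> 'e \<Rightarrow> real"

definition riemannian_metric ::
    "('m::topological_space, 'e::euclidean_space) chart set \<Rightarrow> ('m, 'e) metric_field \<Rightarrow> bool" where
  "riemannian_metric A g \<longleftrightarrow>
     (\<forall>a\<in>A. \<forall>p\<in>chart_dom a. bilinear (g a p) \<and> (\<forall>v w. g a p v w = g a p w v) \<and>
        (\<forall>v. v \<noteq> 0 \<longrightarrow> g a p v v > 0)) \<and>
     (\<forall>a\<in>A. \<forall>v w. smooth_on (coord a ` chart_dom a) (\<lambda>x. g a (chart_inv a x) v w)) \<and>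
     (\<forall>a\<in>A. \<forall>b\<in>A. \<forall>p \<in> chart_dom a \<inter> chart_dom b. \<forall>v w.
        g a p v w = g b p (jac a b p v) (jac a b p w))"

definition conformal_change ::
    "('m \<Rightarrow> real) \<Rightarrow> ('m, 'e) metric_field \<Rightarrow> ('m, 'e) metric_field" where
  "conformal_change \<mu> g = (\<lambda>a p v w. (\<mu> p)\<^sup>2 * g a p v w)"

(* Directional derivative, along v, of the component g(w,y) in the chart a. *)
definition metric_deriv ::
    "('m, 'e::euclidean_space) metric_field \<Rightarrow> ('m, 'e) chart \<Rightarrow> 'm \<Rightarrow> 'e \<Rightarrow> 'e \<Rightarrow> 'e \<Rightarrow> real" where
  "metric_deriv g a p v w y =
     frechet_derivative (\<lambda>x. g a (chart_inv a x) w y) (at (coord a p)) v"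

(* Koszul formula for constant coordinate fields: christoffel g a p v w has the components of
   the Levi-Civita derivative of w along v in the chart a. *)
definition christoffel ::
    "('m, 'e::euclidean_space) metric_field \<Rightarrow> ('m, 'e) chart \<Rightarrow> 'm \<Rightarrow> 'e \<Rightarrow> 'e \<Rightarrow> 'e" where
  "christoffel g a p v w =
     (THE u. \<forall>y. 2 * g a p u y =
        metric_deriv g a p v w y + metric_deriv g a p w v y - metric_deriv g a p y v w)"

(* R(v,w)u with the sign R(X,Y) = [D_X, D_Y] - D_[X,Y]. *)
definition curvature ::
    "('m, 'e::euclidean_space) metric_field \<Rightarrow> ('m, 'e) chart \<Rightarrow> 'm \<Rightarrow> 'e \<Rightarrow> 'e \<Rightarrow> 'e \<Rightarrow> 'e" where
  "curvature g a p v w u =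
     frechet_derivative (\<lambda>x. christoffel g a (chart_inv a x) w u) (at (coord a p)) v
     - frechet_derivative (\<lambda>x. christoffel g a (chart_inv a x) v u) (at (coord a p)) w
     + christoffel g a p v (christoffel g a p w u)
     - christoffel g a p w (christoffel g a p v u)"

definition sectional_curvature ::
    "('m, 'e::euclidean_space) metric_field \<Rightarrow> ('m, 'e) chart \<Rightarrow> 'm \<Rightarrow> 'e \<Rightarrow> 'e \<Rightarrow> real" where
  "sectional_curvature g a p v w =
     g a p (curvature g a p v w w) v / (g a p v v * g a p w w - (g a p v w)\<^sup>2)"

definition geodesic ::
    "('m::topological_space, 'e::euclidean_space) chart set \<Rightarrow> ('m, 'e) metric_field \<Rightarrow>
     (real \<Rightarrow> 'm) \<Rightarrow> bool" where
  "geodesic A g \<gamma> \<longleftrightarrow> continuous_on UNIV \<gamma> \<and>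
     (\<forall>a\<in>A. \<exists>\<gamma>'. \<forall>t. \<gamma> t \<in> chart_dom a \<longrightarrow>
        ((coord a \<circ> \<gamma>) has_vector_derivative \<gamma>' t) (at t) \<and>
        (\<gamma>' has_vector_derivative - christoffel g a (\<gamma> t) (\<gamma>' t) (\<gamma>' t)) (at t))"

definition geodesically_complete ::
    "('m::topological_space, 'e::euclidean_space) chart set \<Rightarrow> ('m, 'e) metric_field \<Rightarrow> bool" where
  "geodesically_complete A g \<longleftrightarrow>
     (\<forall>a\<in>A. \<forall>p\<in>chart_dom a. \<forall>v. \<exists>\<gamma>. geodesic A g \<gamma> \<and> \<gamma> 0 = p \<and>
        ((coord a \<circ> \<gamma>) has_vector_derivative v) (at 0))"

definition space_form4 ::
    "real \<Rightarrow> ('q::topological_space, real^4) chart set \<Rightarrow> ('q, real^4) metric_field \<Rightarrow> bool" where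
  "space_form4 c B g \<longleftrightarrow> oriented_atlas B \<and> riemannian_metric B g \<and>
     simply_connected (UNIV :: 'q set) \<and> geodesically_complete B g \<and>
     (\<forall>b\<in>B. \<forall>q\<in>chart_dom b. \<forall>v w. independent {v, w} \<and> v \<noteq> w \<longrightarrow>
        sectional_curvature g b q v w = c)"


section \<open>Immersions of surfaces\<close>

definition local_rep ::
    "('n, 'd) chart \<Rightarrow> ('q, 'e) chart \<Rightarrow> ('n \<Rightarrow> 'q) \<Rightarrow> 'd \<Rightarrow> 'e" where
  "local_rep a b F = coord b \<circ> F \<circ> chart_inv a"

definition local_dom :: "('n, 'd) chart \<Rightarrow> ('q, 'e) chart \<Rightarrow> ('n \<Rightarrow> 'q) \<Rightarrow> 'n set" where
  "local_dom a b F = {p \<in> chart_dom a. F p \<in> chart_dom b}"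

definition differential ::
    "('n, 'd::euclidean_space) chart \<Rightarrow> ('q, 'e::euclidean_space) chart \<Rightarrow> ('n \<Rightarrow> 'q) \<Rightarrow> 'n \<Rightarrow> 'd \<Rightarrow> 'e"
  where
  "differential a b F p = frechet_derivative (local_rep a b F) (at (coord a p))"

definition smooth_immersion ::
    "('n::topological_space, 'd::euclidean_space) chart set \<Rightarrow>
     ('q::topological_space, 'e::euclidean_space) chart set \<Rightarrow> ('n \<Rightarrow> 'q) \<Rightarrow> bool" where
  "smooth_immersion A B F \<longleftrightarrow> continuous_on UNIV F \<and>
     (\<forall>a\<in>A. \<forall>b\<in>B. smooth_on (coord a ` local_dom a b F) (local_rep a b F) \<and>
        (\<forall>p\<in>local_dom a b F. inj (differential a b F p)))"

(* The induced metric F^*g. The chart at F p may be chosen arbitrarily, because the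
   components of g transform tensorially. *)
definition pullback ::
    "('q, 'e::euclidean_space) chart set \<Rightarrow> ('q, 'e) metric_field \<Rightarrow> ('n \<Rightarrow> 'q) \<Rightarrow>
     ('n, 'd::euclidean_space) metric_field" where
  "pullback B g F = (\<lambda>a p v w.
     let b = (SOME b. b \<in> B \<and> F p \<in> chart_dom b)
     in g b (F p) (differential a b F p v) (differential a b F p w))"

definition conformal_immersion ::
    "('n::topological_space, complex) chart set \<Rightarrow> ('q::topological_space, real^4) chart set \<Rightarrow>
     ('q, real^4) metric_field \<Rightarrow> ('n \<Rightarrow> 'q) \<Rightarrow> bool" where
  "conformal_immersion A B g F \<longleftrightarrow> smooth_immersion A B F \<and>
     (\<forall>a\<in>A. \<forall>p\<in>chart_dom a. \<exists>\<kappa>>0. \<forall>v w. pullback B g F a p v w = \<kappa> * (v \<bullet> w))"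

(* Complex charts of the oriented Riemannian surface with oriented atlas A and metric h:
   positively oriented isothermal charts. The number Im (cnj (J 1) * J i) is the determinant of
   the real-linear map J on the complex plane. *)
definition complex_chart ::
    "('n::topological_space, complex) chart set \<Rightarrow> ('n, complex) metric_field \<Rightarrow>
     ('n, complex) chart \<Rightarrow> bool" where
  "complex_chart A h z \<longleftrightarrow> is_chart z \<and>
     (\<forall>a\<in>A. smooth_on (overlap z a) (transition z a) \<and> smooth_on (overlap a z) (transition a z) \<and>
        (\<forall>p \<in> chart_dom z \<inter> chart_dom a. let J = jac z a p in
           Im (cnj (J 1) * J \<i>) > 0 \<and>
           (\<exists>\<kappa>>0. \<forall>v w. h a p (J v) (J w) = \<kappa> * (v \<bullet> w))))"


section \<open>The normal bundle\<close>

(* Here G is an inner product on the model space and L is the differential of the immersion at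
   a point, so that range L is the tangent plane. *)

definition normal_space ::
    "(real^4 \<Rightarrow> real^4 \<Rightarrow> real) \<Rightarrow> (complex \<Rightarrow> real^4) \<Rightarrow> (real^4) set" where
  "normal_space G L = {Y. \<forall>v. G Y (L v) = 0}"

definition normal_part ::
    "(real^4 \<Rightarrow> real^4 \<Rightarrow> real) \<Rightarrow> (complex \<Rightarrow> real^4) \<Rightarrow> real^4 \<Rightarrow> real^4" where
  "normal_part G L X = (THE Y. Y \<in> normal_space G L \<and> X - Y \<in> range L)"

(* Rotation J by +pi/2 in the normal plane, oriented so that (F_x, F_y, Y, J Y) is positive. *)
definition normal_rot ::
    "(real^4 \<Rightarrow> real^4 \<Rightarrow> real) \<Rightarrow> (complex \<Rightarrow> real^4) \<Rightarrow> real^4 \<Rightarrow> real^4" where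
  "normal_rot G L Y = (THE Z. Z \<in> normal_space G L \<and> G Z Y = 0 \<and> G Z Z = G Y Y \<and>
     (Y \<noteq> 0 \<longrightarrow> det (vector [L 1, L \<i>, Y, Z] :: real^4^4) > 0))"

definition re_vec :: "complex^4 \<Rightarrow> real^4" where
  "re_vec \<xi> = (\<chi> k. Re (\<xi> $ k))"

definition im_vec :: "complex^4 \<Rightarrow> real^4" where
  "im_vec \<xi> = (\<chi> k. Im (\<xi> $ k))"

definition complex_vec :: "real^4 \<Rightarrow> real^4 \<Rightarrow> complex^4" where
  "complex_vec X Y = (\<chi> k. Complex (X $ k) (Y $ k))"

(* Complex-linear extension of a real-linear map. *)
definition complexify :: "(real^4 \<Rightarrow> real^4) \<Rightarrow> complex^4 \<Rightarrow> complex^4" where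
  "complexify T \<xi> = complex_vec (T (re_vec \<xi>)) (T (im_vec \<xi>))"

(* The fibre of the isotropic line bundle: J xi = - s i xi, where s is 1 or -1. *)
definition isotropic_normal ::
    "real \<Rightarrow> (real^4 \<Rightarrow> real^4 \<Rightarrow> real) \<Rightarrow> (complex \<Rightarrow> real^4) \<Rightarrow> (complex^4) set" where
  "isotropic_normal s G L = {\<xi>. re_vec \<xi> \<in> normal_space G L \<and> im_vec \<xi> \<in> normal_space G L \<and>
     complexify (normal_rot G L) \<xi> = (- complex_of_real s * \<i>) *s \<xi>}"

(* Components in b of alpha(v,w), where v and w are constant vectors in the coordinates z. *)
definition second_fundamental_form ::
    "('q, real^4) metric_field \<Rightarrow> ('n \<Rightarrow> 'q) \<Rightarrow> ('n, complex) chart \<Rightarrow> ('q, real^4) chart \<Rightarrow> 'n \<Rightarrow>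
     complex \<Rightarrow> complex \<Rightarrow> real^4" where
  "second_fundamental_form g F z b p v w =
     (let L = differential z b F p in
      normal_part (g b (F p)) L
        (frechet_derivative (\<lambda>x. frechet_derivative (local_rep z b F) (at x) w) (at (coord z p)) v
         + christoffel g b (F p) (L v) (L w)))"

(* alpha(d/dz, d/dz) with d/dz = (d/dx - i d/dy) / 2. *)
definition alpha_zz ::
    "('q, real^4) metric_field \<Rightarrow> ('n \<Rightarrow> 'q) \<Rightarrow> ('n, complex) chart \<Rightarrow> ('q, real^4) chart \<Rightarrow> 'n \<Rightarrow>
     complex^4" where
  "alpha_zz g F z b p =
     (let \<alpha> = second_fundamental_form g F z b p in
      complex_vec ((1/4) *\<^sub>R (\<alpha> 1 1 - \<alpha> \<i> \<i>)) (- (1/4) *\<^sub>R (\<alpha> 1 \<i> + \<alpha> \<i> 1)))"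

definition isotropic_part ::
    "real \<Rightarrow> ('q, real^4) metric_field \<Rightarrow> ('n \<Rightarrow> 'q) \<Rightarrow> ('n, complex) chart \<Rightarrow>
     ('q, real^4) chart \<Rightarrow> 'n \<Rightarrow> complex^4" where
  "isotropic_part s g F z b p =
     (1/2) *s (alpha_zz g F z b p + (complex_of_real s * \<i>) *s
        complexify (normal_rot (g b (F p)) (differential z b F p)) (alpha_zz g F z b p))"

(* A complexified vector field along F is a function xi, where xi b p has the components in b of
   the vector at p. *)
type_synonym ('n, 'q) field_along = "('q, real^4) chart \<Rightarrow> 'n \<Rightarrow> complex^4"

definition isotropic_section ::
    "real \<Rightarrow> ('q, real^4) chart set \<Rightarrow> ('q, real^4) metric_field \<Rightarrow> ('n \<Rightarrow> 'q) \<Rightarrow>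
     ('n, complex) chart \<Rightarrow> ('n, 'q) field_along \<Rightarrow> bool" where
  "isotropic_section s B g F z \<xi> \<longleftrightarrow>
     (\<forall>b\<in>B. smooth_on (coord z ` local_dom z b F) (\<xi> b \<circ> chart_inv z) \<and>
        (\<forall>p\<in>local_dom z b F.
           \<xi> b p \<in> isotropic_normal s (g b (F p)) (differential z b F p) \<and>
           (\<forall>b'\<in>B. F p \<in> chart_dom b' \<longrightarrow> \<xi> b' p = complexify (jac b b' (F p)) (\<xi> b p))))"

(* Normal covariant derivative along the constant coordinate vector v of z. *)
definition normal_deriv ::
    "('q, real^4) metric_field \<Rightarrow> ('n \<Rightarrow> 'q) \<Rightarrow> ('n, complex) chart \<Rightarrow> ('q, real^4) chart \<Rightarrow>
     ('n, 'q) field_along \<Rightarrow> 'n \<Rightarrow> complex \<Rightarrow> complex^4" where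
  "normal_deriv g F z b \<xi> p v =
     (let L = differential z b F p in
      complexify (normal_part (g b (F p)) L)
        (frechet_derivative (\<xi> b \<circ> chart_inv z) (at (coord z p)) v
         + complexify (christoffel g b (F p) (L v)) (\<xi> b p)))"

definition holomorphic_section ::
    "('q, real^4) chart set \<Rightarrow> ('q, real^4) metric_field \<Rightarrow> ('n \<Rightarrow> 'q) \<Rightarrow> ('n, complex) chart \<Rightarrow>
     ('n, 'q) field_along \<Rightarrow> bool" where
  "holomorphic_section B g F z \<xi> \<longleftrightarrow>
     (\<forall>b\<in>B. \<forall>p\<in>local_dom z b F.
        (1/2) *s (normal_deriv g F z b \<xi> p 1 + \<i> *s normal_deriv g F z b \<xi> p \<i>) = 0)"


section \<open>Isotropically isothermic surfaces\<close>

definition isotropically_isothermic_sign ::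
    "real \<Rightarrow> ('n::topological_space, complex) chart set \<Rightarrow> ('n, complex) metric_field \<Rightarrow>
     ('q, real^4) chart set \<Rightarrow> ('q, real^4) metric_field \<Rightarrow> ('n \<Rightarrow> 'q) \<Rightarrow> bool" where
  "isotropically_isothermic_sign s A h B g F \<longleftrightarrow>
     (\<forall>z. complex_chart A h z \<longrightarrow>
        (\<forall>b\<in>B. \<forall>p\<in>local_dom z b F. isotropic_part s g F z b p \<noteq> 0) \<and>
        (simply_connected (chart_dom z) \<longrightarrow>
          (\<exists>D \<xi>. (\<forall>p\<in>chart_dom z. D p > 0) \<and>
             smooth_on (coord z ` chart_dom z) (D \<circ> chart_inv z) \<and>
             isotropic_section s B g F z \<xi> \<and> holomorphic_section B g F z \<xi> \<and>
             (\<forall>b\<in>B. \<forall>p\<in>local_dom z b F.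
                \<xi> b p \<noteq> 0 \<and>
                isotropic_part s g F z b p = complex_of_real (D p) *s \<xi> b p))))"

(* A and h are the oriented atlas and the metric of the surface, B and g those of the ambient
   4-manifold, and F is an isometric immersion. *)
definition isotropically_isothermic ::
    "('n::topological_space, complex) chart set \<Rightarrow> ('n, complex) metric_field \<Rightarrow>
     ('q, real^4) chart set \<Rightarrow> ('q, real^4) metric_field \<Rightarrow> ('n \<Rightarrow> 'q) \<Rightarrow> bool" where
  "isotropically_isothermic A h B g F \<longleftrightarrow>
     (\<exists>s\<in>{1, -1}. isotropically_isothermic_sign s A h B g F)"

end

(* For g' = mu^2 g the Levi-Civita connection changes by
     D'_v w - D_v w = theta(v) w + theta(w) v - g(v,w) grad log mu,   theta = d log mu,
   while orthogonality, normal projection and the normal rotation are the same for g and g'.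
   Hence the second fundamental form changes by a normal field times the induced metric, and its
   (d/dz,d/dz) part, and with it phi, is unchanged in a complex chart. The normal connection
   changes by theta(v), so if xi is holomorphic for g, then xi / (mu o F) is holomorphic for g', and
   phi = D xi becomes phi = ((mu o F) D) (xi / (mu o F)). The converse is the same statement for
   1/mu and g'. *)
theory Submission
  imports Defs
begin

section \<open>Calculus of smooth functions\<close>

text \<open>The geometric computation is short; the encoding shapes the proof.
  \<open>christoffel\<close>, \<open>normal_part\<close> and \<open>normal_rot\<close> are definite
  descriptions, which carry information only once existence and uniqueness are known; both are
  reduced to linear algebra of one inner product and one conformal linear map. The ambient chart
  inside \<open>pullback\<close> is an arbitrary choice, and a complex chart is any positively
  oriented isothermal chart rather than a member of the atlas, so smoothness and conformality have
  to be carried over by changes of coordinates. The weight -1 of the section has this origin. When a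
  normal field Y is differentiated along v, the term \<theta>(Y) v is tangent, the gradient term has
  the coefficient g(v,Y) = 0, and \<theta>(v) Y remains, which the derivative of 1/\<mu> cancels.
  The factor \<mu> lost by the section is absorbed by D, which only has to stay smooth and positive.
  All this happens for a fixed sign s, so each of the two signed conditions is invariant by
  itself.\<close>

lemma Ck_on_subset: "Ck_on k f S \<Longrightarrow> T \<subseteq> S \<Longrightarrow> Ck_on k f T"
  by (induction k arbitrary: f) (auto intro: continuous_on_subset)

text \<open>Derivatives \<open>at x\<close> see only a neighbourhood of x, and the open set T turns
  continuity on T into continuity at x. This glues statements proved near each point of a complex
  chart.\<close>

lemma Ck_on_local:
  assumes "\<And>x. x \<in> S \<Longrightarrow> \<exists>T. open T \<and> x \<in> T \<and> Ck_on k f T"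
  shows "Ck_on k f S"
  using assms
proof (induction k arbitrary: f)
  case 0
  then show ?case
    by (metis Ck_on.simps(1) continuous_at_imp_continuous_on continuous_on_eq_continuous_at)
next
  case (Suc k)
  have "f differentiable (at x)" if "x \<in> S" for x
    using Suc.prems[OF that] by auto
  moreover have "Ck_on k (\<lambda>x. frechet_derivative f (at x) v) S" for v
  proof (rule Suc.IH)
    fix x assume "x \<in> S"
    from Suc.prems[OF this] show "\<exists>T. open T \<and> x \<in> T \<and> Ck_on k (\<lambda>x. frechet_derivative f (at x) v) T"
      by auto
  qed
  ultimately show ?case by simp
qed

lemma Ck_on_cong:
  assumes "open S" "\<And>x. x \<in> S \<Longrightarrow> f x = h x" "Ck_on k f S"
  shows "Ck_on k h S"
  using assms(2,3)
proof (induction k arbitrary: f h)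
  case 0
  then show ?case using continuous_on_cong[of S S f h] by simp
next
  case (Suc k)
  have D: "(h has_derivative frechet_derivative f (at x)) (at x)" if "x \<in> S" for x
  proof (rule has_derivative_transform_within_open[OF _ \<open>open S\<close> that])
    show "(f has_derivative frechet_derivative f (at x)) (at x)"
      using Suc.prems(2) that frechet_derivative_works by auto
  qed (use Suc.prems(1) in auto)
  have "Ck_on k (\<lambda>x. frechet_derivative h (at x) v) S" for v
  proof (rule Suc.IH)
    show "Ck_on k (\<lambda>x. frechet_derivative f (at x) v) S" using Suc.prems(2) by simp
    show "frechet_derivative f (at x) v = frechet_derivative h (at x) v" if "x \<in> S" for x
      by (simp add: frechet_derivative_at[OF D[OF that], symmetric])
  qed
  then show ?case using D by (auto simp: differentiable_def)
qed

text \<open>Serves as the inductive step below: any formula for the derivative may stand in for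
  \<open>frechet_derivative\<close>, so the recursion of \<open>Ck_on\<close> can be run on sum,
  product and chain rule expressions.\<close>

lemma Ck_on_Suc_has_derivative:
  assumes "open S" "\<And>x. x \<in> S \<Longrightarrow> (f has_derivative f' x) (at x)"
    and "\<And>v. Ck_on k (\<lambda>x. f' x v) S"
  shows "Ck_on (Suc k) f S"
proof -
  have "frechet_derivative f (at x) = f' x" if "x \<in> S" for x
    using frechet_derivative_at[OF assms(2)[OF that]] by simp
  then have "Ck_on k (\<lambda>x. frechet_derivative f (at x) v) S" for v
    by (intro Ck_on_cong[OF assms(1) _ assms(3)[of v]]) simp
  then show ?thesis using assms(2) by (auto simp: differentiable_def)
qed

lemma Ck_on_has_derivative:
  "Ck_on (Suc k) f S \<Longrightarrow> x \<in> S \<Longrightarrow> (f has_derivative frechet_derivative f (at x)) (at x)"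
  by (simp add: frechet_derivative_works[symmetric])

lemma Ck_on_SucD: "Ck_on (Suc k) f S \<Longrightarrow> Ck_on k f S"
proof (induction k arbitrary: f)
  case 0
  then show ?case
    by (metis Ck_on.simps continuous_at_imp_continuous_on differentiable_imp_continuous_within)
qed simp

lemma Ck_on_const:
  assumes "open S"
  shows "Ck_on k (\<lambda>x. c) S"
proof (induction k arbitrary: c)
  case (Suc k)
  then show ?case
    by (intro Ck_on_Suc_has_derivative[OF assms, where f'="\<lambda>_ _. 0"]) auto
qed simp

lemma Ck_on_add:
  assumes "open S" "Ck_on k f S" "Ck_on k h S"
  shows "Ck_on k (\<lambda>x. f x + h x) S"
  using assms(2,3)
proof (induction k arbitrary: f h)
  case (Suc k)
  show ?case
    by (rule Ck_on_Suc_has_derivative[OF assms(1)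
          has_derivative_add[OF Ck_on_has_derivative[OF Suc.prems(1)] Ck_on_has_derivative[OF Suc.prems(2)]]])
       (use Suc in auto)
qed (auto intro!: continuous_intros)

lemma Ck_on_sum:
  assumes "open S" "finite I" "\<And>i. i \<in> I \<Longrightarrow> Ck_on k (f i) S"
  shows "Ck_on k (\<lambda>x. \<Sum>i\<in>I. f i x) S"
  using assms(2,3) by (induction I) (simp_all add: Ck_on_const Ck_on_add assms(1))

lemma Ck_on_bounded_linear:
  assumes "open S" "bounded_linear T" "Ck_on k f S"
  shows "Ck_on k (\<lambda>x. T (f x)) S"
  using assms(3)
proof (induction k arbitrary: f)
  case 0
  then show ?case using bounded_linear.continuous_on[OF assms(2)] by simp
next
  case (Suc k)
  show ?case
    by (rule Ck_on_Suc_has_derivative[OF assms(1)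
          bounded_linear.has_derivative[OF assms(2) Ck_on_has_derivative[OF Suc.prems]]])
       (use Suc in auto)
qed

lemma Ck_on_scaleR:
  fixes r :: "'a::euclidean_space \<Rightarrow> real"
  assumes "open S" "Ck_on k r S" "Ck_on k f S"
  shows "Ck_on k (\<lambda>x. r x *\<^sub>R f x) S"
  using assms(2,3)
proof (induction k arbitrary: r f)
  case (Suc k)
  have "Ck_on k r S" "Ck_on k f S" using Suc.prems Ck_on_SucD by auto
  with Suc show ?case
    by (intro Ck_on_Suc_has_derivative[OF assms(1)
          has_derivative_scaleR[OF Ck_on_has_derivative[OF Suc.prems(1)] Ck_on_has_derivative[OF Suc.prems(2)]]]
         Ck_on_add[OF assms(1)]) simp_all
qed (auto intro!: continuous_intros)

text \<open>In the chain rule the direction f' x v fed to h' varies with x, while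
  \<open>Ck_on\<close> speaks of constant directions. Expanding f' x v in the basis leaves scalar
  functions times h' along a fixed basis vector, composed with f; the latter falls under the
  induction hypothesis, which is general in h.\<close>

lemma Ck_on_compose:
  fixes f :: "'a::euclidean_space \<Rightarrow> 'b::euclidean_space" and h :: "'b \<Rightarrow> 'c::real_normed_vector"
  assumes "open S" "f ` S \<subseteq> T" "Ck_on k f S" "Ck_on k h T"
  shows "Ck_on k (h \<circ> f) S"
  using assms(3,4)
proof (induction k arbitrary: h)
  case 0
  then show ?case using continuous_on_compose[of S f h] continuous_on_subset[of T h "f ` S"] assms(2) by simp
next
  case (Suc k)
  let ?h' = "\<lambda>y. frechet_derivative h (at y)" and ?f' = "\<lambda>x. frechet_derivative f (at x)"
  have Df: "(f has_derivative ?f' x) (at x)" and Dh: "(h has_derivative ?h' (f x)) (at (f x))"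
    if "x \<in> S" for x
    using that assms(2) Ck_on_has_derivative[OF Suc.prems(1)] Ck_on_has_derivative[OF Suc.prems(2)]
    by auto
  have D: "(h \<circ> f has_derivative (\<lambda>v. \<Sum>i\<in>Basis. (?f' x v \<bullet> i) *\<^sub>R ?h' (f x) i)) (at x)"
    if "x \<in> S" for x
  proof -
    have lin: "linear (?h' (f x))" using Dh[OF that] by (rule has_derivative_linear)
    have "?h' (f x) (\<Sum>i\<in>Basis. (w \<bullet> i) *\<^sub>R i) = (\<Sum>i\<in>Basis. (w \<bullet> i) *\<^sub>R ?h' (f x) i)" for w
      unfolding linear_sum[OF lin] linear_cmul[OF lin] ..
    then have "?h' (f x) \<circ> ?f' x = (\<lambda>v. \<Sum>i\<in>Basis. (?f' x v \<bullet> i) *\<^sub>R ?h' (f x) i)"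
      unfolding euclidean_representation o_def by (intro ext)
    with diff_chain_at[OF Df[OF that] Dh[OF that]] show ?thesis by (simp only:)
  qed
  show ?case
  proof (rule Ck_on_Suc_has_derivative[OF assms(1) D])
    fix v
    show "Ck_on k (\<lambda>x. \<Sum>i\<in>Basis. (?f' x v \<bullet> i) *\<^sub>R ?h' (f x) i) S"
    proof (intro Ck_on_sum Ck_on_scaleR assms(1) finite_Basis)
      fix i :: 'b
      show "Ck_on k (\<lambda>x. ?f' x v \<bullet> i) S"
        using Suc.prems(1) by (intro Ck_on_bounded_linear[OF assms(1) bounded_linear_inner_left]) simp
      show "Ck_on k (\<lambda>x. ?h' (f x) i) S"
        using Suc.IH[of "\<lambda>y. ?h' y i"] Suc.prems Ck_on_SucD[OF Suc.prems(1)] by (simp add: o_def)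
    qed
  qed
qed

text \<open>The derivative is again a product of copies of the inverse, so the induction closes on
  itself.\<close>

lemma Ck_on_inverse: "Ck_on k inverse {0::real<..}"
proof (induction k)
  case (Suc k)
  then have "Ck_on k (\<lambda>x. (- v) *\<^sub>R (inverse x *\<^sub>R inverse x)) {0::real<..}" for v
    by (intro Ck_on_scaleR Ck_on_const open_greaterThan)
  then show ?case
    by (intro Ck_on_Suc_has_derivative[OF open_greaterThan,
          where f'="\<lambda>x v. (- v) *\<^sub>R (inverse x *\<^sub>R inverse x)"])
       (auto intro!: derivative_eq_intros)
qed (auto intro!: continuous_intros)

lemma smooth_on_has_derivative:
  "smooth_on S f \<Longrightarrow> x \<in> S \<Longrightarrow> (f has_derivative frechet_derivative f (at x)) (at x)"
  unfolding smooth_on_def using Ck_on_has_derivative by blast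

lemma smooth_on_local:
  "(\<And>x. x \<in> S \<Longrightarrow> \<exists>T. open T \<and> x \<in> T \<and> smooth_on T f) \<Longrightarrow> smooth_on S f"
  unfolding smooth_on_def by (metis Ck_on_local)

lemma smooth_on_subset: "smooth_on S f \<Longrightarrow> T \<subseteq> S \<Longrightarrow> smooth_on T f"
  unfolding smooth_on_def using Ck_on_subset by blast

lemma smooth_on_cong:
  "smooth_on S f \<Longrightarrow> open S \<Longrightarrow> (\<And>x. x \<in> S \<Longrightarrow> f x = h x) \<Longrightarrow> smooth_on S h"
  unfolding smooth_on_def using Ck_on_cong by blast

lemma smooth_on_scaleR:
  fixes r :: "'a::euclidean_space \<Rightarrow> real"
  shows "open S \<Longrightarrow> smooth_on S r \<Longrightarrow> smooth_on S f \<Longrightarrow> smooth_on S (\<lambda>x. r x *\<^sub>R f x)"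
  unfolding smooth_on_def using Ck_on_scaleR by blast

lemma smooth_on_compose:
  fixes f :: "'a::euclidean_space \<Rightarrow> 'b::euclidean_space" and h :: "'b \<Rightarrow> 'c::real_normed_vector"
  shows "smooth_on S f \<Longrightarrow> smooth_on T h \<Longrightarrow> open S \<Longrightarrow> f ` S \<subseteq> T \<Longrightarrow> smooth_on S (h \<circ> f)"
  unfolding smooth_on_def using Ck_on_compose by blast

lemma smooth_on_inverse:
  fixes r :: "'a::euclidean_space \<Rightarrow> real"
  assumes "open S" "smooth_on S r" "\<And>x. x \<in> S \<Longrightarrow> r x > 0"
  shows "smooth_on S (\<lambda>x. inverse (r x))"
proof -
  have "smooth_on {0::real<..} inverse" unfolding smooth_on_def using Ck_on_inverse by blast
  then have "smooth_on S (inverse \<circ> r)" using assms by (intro smooth_on_compose) auto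
  then show ?thesis by (simp add: o_def)
qed

section \<open>Charts\<close>

lemma chart_inv_coord: "is_chart a \<Longrightarrow> p \<in> chart_dom a \<Longrightarrow> chart_inv a (coord a p) = p"
  unfolding is_chart_def homeomorphism_def by blast

lemma open_coord_image:
  assumes "is_chart a" "open U" "U \<subseteq> chart_dom a"
  shows "open (coord a ` U)"
proof -
  have "openin (top_of_set (chart_dom a)) U"
    using assms by (simp add: is_chart_def openin_open_eq)
  then have "openin (top_of_set (coord a ` chart_dom a)) (coord a ` U)"
    using assms(1) homeomorphism_imp_open_map unfolding is_chart_def by blast
  then show ?thesis using assms(1) by (simp add: is_chart_def openin_open_eq)
qed

lemma open_local_dom:
  assumes "is_chart a" "is_chart b" "continuous_on UNIV F"
  shows "open (local_dom a b F)"
proof -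
  have "local_dom a b F = chart_dom a \<inter> F -` chart_dom b" by (auto simp: local_dom_def)
  moreover have "open (F -` chart_dom b)"
    using assms(2,3) by (intro open_vimage) (auto simp: is_chart_def)
  ultimately show ?thesis using assms(1) by (simp add: is_chart_def open_Int)
qed

lemma local_rep_coord:
  "is_chart a \<Longrightarrow> p \<in> chart_dom a \<Longrightarrow> local_rep a b F (coord a p) = coord b (F p)"
  by (simp add: local_rep_def chart_inv_coord)

lemma transition_coord:
  "is_chart a \<Longrightarrow> p \<in> chart_dom a \<Longrightarrow> transition a b (coord a p) = coord b p"
  by (simp add: transition_def chart_inv_coord)

lemma smooth_atlas_chart: "smooth_atlas B \<Longrightarrow> b \<in> B \<Longrightarrow> is_chart b"
  by (simp add: smooth_atlas_def)

lemma jac_has_derivative: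
  assumes "smooth_on (overlap a b) (transition a b)" "p \<in> chart_dom a \<inter> chart_dom b"
  shows "(transition a b has_derivative jac a b p) (at (coord a p))"
  unfolding jac_def using assms by (intro smooth_on_has_derivative[OF assms(1)]) (auto simp: overlap_def)

text \<open>A chain rule composite is the coordinate expression of F only near p, and the derivative
  at p sees no more than that. Changes of chart in the surface and in the ambient manifold are both
  handled this way.\<close>

lemma differential_eq:
  assumes "(h has_derivative D) (at (coord a p))" "is_chart a" "open U" "U \<subseteq> chart_dom a" "p \<in> U"
    and "\<And>q. q \<in> U \<Longrightarrow> h (coord a q) = coord b (F q)"
  shows "differential a b F p = D"
proof -
  have "(local_rep a b F has_derivative D) (at (coord a p))"
    by (rule has_derivative_transform_within_open[OF assms(1) open_coord_image[OF assms(2,3,4)]])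
       (use assms in \<open>auto simp: local_rep_coord\<close>)
  then show ?thesis unfolding differential_def by (rule frechet_derivative_at[symmetric])
qed

section \<open>Inner products on the model space\<close>

text \<open>The pointwise content of \<open>riemannian_metric\<close>, isolated so that projection,
  rotation and the Koszul formula become questions about one form on the model space.\<close>

definition inner_form :: "('e::euclidean_space \<Rightarrow> 'e \<Rightarrow> real) \<Rightarrow> bool" where
  "inner_form G \<longleftrightarrow> bilinear G \<and> (\<forall>v w. G v w = G w v) \<and> (\<forall>v. v \<noteq> 0 \<longrightarrow> G v v > 0)"

context
  fixes G :: "'e::euclidean_space \<Rightarrow> 'e \<Rightarrow> real"
  assumes G: "inner_form G"
begin

lemma inner_form_linear: "linear (G v)" "linear (\<lambda>v. G v w)"
  using G by (auto simp: inner_form_def bilinear_def)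

lemma inner_form_simps:
  "G (u + v) w = G u w + G v w" "G (u - v) w = G u w - G v w" "G (r *\<^sub>R v) w = r * G v w"
  "G w (u + v) = G w u + G w v" "G w (u - v) = G w u - G w v" "G w (r *\<^sub>R v) = r * G w v"
  "G 0 w = 0" "G w 0 = 0" "G (- v) w = - G v w" "G w (- v) = - G w v"
  using linear_add[OF inner_form_linear(1)] linear_diff[OF inner_form_linear(1)]
    linear_cmul[OF inner_form_linear(1)] linear_0[OF inner_form_linear(1)] linear_neg[OF inner_form_linear(1)]
    linear_add[OF inner_form_linear(2)] linear_diff[OF inner_form_linear(2)]
    linear_cmul[OF inner_form_linear(2)] linear_0[OF inner_form_linear(2)] linear_neg[OF inner_form_linear(2)]
  by simp_all

lemma inner_form_commute: "G v w = G w v"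
  using G by (simp add: inner_form_def)

lemma inner_form_eq_zero_iff: "G v v = 0 \<longleftrightarrow> v = 0"
  using G inner_form_simps(7) unfolding inner_form_def by force

lemma inner_form_eqI:
  assumes "\<And>y. G u y = G v y"
  shows "u = v"
  using inner_form_eq_zero_iff[of "u - v"] assms by (simp add: inner_form_simps)

text \<open>Definiteness makes the passage from u to the functional \<open>G u\<close> injective,
  and equality of dimensions makes it surjective; T writes it in Euclidean coordinates. It supplies
  the Christoffel vector, the gradient of log \<mu> and normal vectors.\<close>

lemma inner_form_riesz:
  assumes "linear \<phi>"
  shows "\<exists>u. \<forall>y. G u y = \<phi> y"
proof -
  define T where "T u = (\<Sum>i\<in>Basis. G u i *\<^sub>R i)" for u
  have T: "T u \<bullet> i = G u i" if "i \<in> Basis" for u i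
    using that by (simp add: T_def inner_sum_left inner_Basis if_distrib cong: if_cong)
  have "linear T"
    by (rule linearI)
       (simp_all add: T_def inner_form_simps sum.distrib scaleR_add_left scaleR_sum_right)
  moreover have "u = 0" if "T u = 0" for u
  proof -
    have "G u i = (\<lambda>_. 0) i" if "i \<in> Basis" for i using T[OF that, of u] \<open>T u = 0\<close> by simp
    then have "G u = (\<lambda>_. 0)"
      by (intro ext linear_eq_stdbasis[OF inner_form_linear(1) linear_zero])
    then show ?thesis using inner_form_eq_zero_iff by metis
  qed
  ultimately have "surj T" by (intro linear_injective_imp_surjective) (auto simp: linear_injective_0)
  then obtain u where "T u = (\<Sum>i\<in>Basis. \<phi> i *\<^sub>R i)" by (metis surj_def)
  then have "G u i = \<phi> i" if "i \<in> Basis" for i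
    using T[OF that, of u] that by (simp add: inner_sum_left inner_Basis if_distrib cong: if_cong)
  then have "G u = \<phi>" by (intro ext linear_eq_stdbasis[OF inner_form_linear(1) assms])
  then show ?thesis by auto
qed

end

section \<open>Projection onto the normal plane of a conformal linear map\<close>

context
  fixes G :: "real^4 \<Rightarrow> real^4 \<Rightarrow> real" and L :: "complex \<Rightarrow> real^4" and \<kappa> :: real
  assumes G: "inner_form G" and L: "linear L"
    and \<kappa>: "\<kappa> > 0" and conf: "\<And>v w. G (L v) (L w) = \<kappa> * (v \<bullet> w)"
begin

lemma linear_complex_expand: "L v = Re v *\<^sub>R L 1 + Im v *\<^sub>R L \<i>"
proof -
  have "v = Re v *\<^sub>R 1 + Im v *\<^sub>R \<i>" by (simp add: complex_eq_iff)
  then show ?thesis using linear_add[OF L, of "Re v *\<^sub>R 1" "Im v *\<^sub>R \<i>"] by (simp only: linear_cmul[OF L])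
qed

lemma normal_space_iff: "Y \<in> normal_space G L \<longleftrightarrow> G Y (L 1) = 0 \<and> G Y (L \<i>) = 0"
proof -
  have "G Y (L v) = Re v * G Y (L 1) + Im v * G Y (L \<i>)" for v
    by (subst linear_complex_expand) (simp only: inner_form_simps[OF G])
  then have "(\<forall>v. G Y (L v) = 0) \<longleftrightarrow> G Y (L 1) = 0 \<and> G Y (L \<i>) = 0"
    by (metis add.right_neutral mult_zero_right)
  then show ?thesis by (simp add: normal_space_def)
qed

text \<open>The difference of two candidates is at once tangent and normal, so its length
  vanishes.\<close>

lemma normal_part_eq:
  assumes "Y \<in> normal_space G L" "X - Y \<in> range L"
  shows "normal_part G L X = Y"
  unfolding normal_part_def
proof (rule the_equality)
  fix Y' assume Y': "Y' \<in> normal_space G L \<and> X - Y' \<in> range L"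
  obtain u v where "X - Y' = L u" "X - Y = L v" using Y' assms(2) by blast
  moreover have "Y - Y' = (X - Y') - (X - Y)" by simp
  ultimately have *: "Y - Y' = L (u - v)" by (simp only: linear_diff[OF L])
  have "G (Y - Y') (L (u - v)) = 0"
    using Y' assms(1) by (simp add: normal_space_def inner_form_simps[OF G])
  then show "Y' = Y" using * inner_form_eq_zero_iff[OF G, of "Y - Y'"] by simp
qed (use assms in simp)

lemma normal_part_in: "normal_part G L X \<in> normal_space G L" "X - normal_part G L X \<in> range L"
proof -
  \<comment> \<open>The vectors \<open>L 1\<close> and \<open>L \<i>\<close> are orthogonal with
    common squared length \<kappa>, so division by \<kappa> gives the tangential coefficients of
    X.\<close>
  define w where "w = Complex (G X (L 1) / \<kappa>) (G X (L \<i>) / \<kappa>)"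
  have "X - L w \<in> normal_space G L" "X - (X - L w) \<in> range L"
    using \<kappa> by (simp_all add: normal_space_iff inner_form_simps(2)[OF G] conf w_def inner_complex_def)
  with normal_part_eq[OF this]
  show "normal_part G L X \<in> normal_space G L" "X - normal_part G L X \<in> range L" by auto
qed

lemma normal_space_linear:
  "Y \<in> normal_space G L \<Longrightarrow> Z \<in> normal_space G L \<Longrightarrow> Y + Z \<in> normal_space G L"
  "Y \<in> normal_space G L \<Longrightarrow> r *\<^sub>R Y \<in> normal_space G L"
  by (auto simp: normal_space_def inner_form_simps[OF G])

text \<open>Linearity of the definite description comes from its uniqueness: sums and multiples of
  projections satisfy the conditions that determine a projection.\<close>

lemma linear_normal_part: "linear (normal_part G L)"
proof (rule linearI)
  fix X Y r
  have R: "subspace (range L)" using L by (simp add: linear_subspace_image)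
  show "normal_part G L (X + Y) = normal_part G L X + normal_part G L Y"
  proof (rule normal_part_eq)
    show "normal_part G L X + normal_part G L Y \<in> normal_space G L"
      by (intro normal_space_linear normal_part_in)
    have "X + Y - (normal_part G L X + normal_part G L Y) = (X - normal_part G L X) + (Y - normal_part G L Y)"
      by simp
    then show "X + Y - (normal_part G L X + normal_part G L Y) \<in> range L"
      using subspace_add[OF R normal_part_in(2)[of X] normal_part_in(2)[of Y]] by (simp only:)
  qed
  show "normal_part G L (r *\<^sub>R X) = r *\<^sub>R normal_part G L X"
  proof (rule normal_part_eq)
    show "r *\<^sub>R normal_part G L X \<in> normal_space G L"
      by (intro normal_space_linear normal_part_in)
    show "r *\<^sub>R X - r *\<^sub>R normal_part G L X \<in> range L"
      using subspace_scale[OF R normal_part_in(2)[of X], of r] by (simp only: scaleR_diff_right)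
  qed
qed

lemma normal_part_tangent: "normal_part G L (L v) = 0"
  by (rule normal_part_eq) (auto simp: normal_space_def inner_form_simps[OF G])

end

section \<open>Orthogonal frames, determinants and the rotation of the normal plane\<close>

lemma transpose_mult_eq_sum_rows:
  fixes A :: "real^'n^'n"
  shows "transpose A *v x = (\<Sum>i\<in>UNIV. x $ i *\<^sub>R A $ i)"
  by (simp add: matrix_mult_sum column_transpose row_def scalar_mult_eq_scaleR vec_nth_inverse)

lemma inner_form_sum_left:
  assumes "inner_form G"
  shows "G (\<Sum>i\<in>I. f i) w = (\<Sum>i\<in>I. G (f i) w)"
  using linear_sum[OF inner_form_linear(2)[OF assms]] .

text \<open>A linear relation among the rows, paired with row j, retains only the coefficient of row
  j, so it is trivial. The transpose enters because \<open>transpose A *v x\<close> combines the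
  rows with coefficients x.\<close>

lemma orthogonal_frame_det_nonzero:
  fixes A :: "real^'n^'n"
  assumes G: "inner_form G"
    and orth: "\<And>i j. i \<noteq> j \<Longrightarrow> G (A $ i) (A $ j) = 0" and nz: "\<And>i. A $ i \<noteq> 0"
  shows "det A \<noteq> 0"
proof -
  have "x = 0" if "transpose A *v x = 0" for x
  proof -
    have "x $ j = 0" for j
    proof -
      have "0 = G (\<Sum>i\<in>UNIV. x $ i *\<^sub>R A $ i) (A $ j)"
        using that unfolding transpose_mult_eq_sum_rows by (simp only: inner_form_simps(7)[OF G])
      also have "\<dots> = (\<Sum>i\<in>UNIV. x $ i * G (A $ i) (A $ j))"
        by (simp add: inner_form_sum_left[OF G] inner_form_simps(3)[OF G])
      also have "\<dots> = (\<Sum>i\<in>UNIV. if i = j then x $ j * G (A $ j) (A $ j) else 0)"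
        using orth by (intro sum.cong) auto
      finally show ?thesis using nz[of j] inner_form_eq_zero_iff[OF G] by simp
    qed
    then show ?thesis by (simp add: vec_eq_iff)
  qed
  then have "\<exists>B. B ** transpose A = mat 1" using matrix_left_invertible_ker by blast
  then have "invertible (transpose A)" by (simp add: invertible_left_inverse)
  then show ?thesis by (simp add: invertible_det_nz)
qed

text \<open>The rows span, so W is a combination of vectors orthogonal to W and has zero
  length.\<close>

lemma orthogonal_to_frame_eq_zero:
  fixes A :: "real^'n^'n"
  assumes G: "inner_form G" and "det A \<noteq> 0" and orth: "\<And>i. G (A $ i) W = 0"
  shows "W = 0"
proof -
  have "invertible (transpose A)" using assms(2) by (simp add: invertible_det_nz)
  then have "surj ((*v) (transpose A))"
    by (simp add: invertible_right_inverse matrix_right_invertible_surjective)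
  then obtain x where "W = transpose A *v x" by (metis surj_def)
  then have "G W W = (\<Sum>i\<in>UNIV. x $ i * G (A $ i) W)"
    by (metis (no_types, lifting) inner_form_sum_left[OF G] inner_form_simps(3)[OF G]
        sum.cong transpose_mult_eq_sum_rows)
  then show ?thesis using orth inner_form_eq_zero_iff[OF G] by simp
qed

lemma vector_4 [simp]:
  "(vector [x1, x2, x3, x4] :: 'a::zero^4) $ 1 = x1" "(vector [x1, x2, x3, x4] :: 'a^4) $ 2 = x2"
  "(vector [x1, x2, x3, x4] :: 'a^4) $ 3 = x3" "(vector [x1, x2, x3, x4] :: 'a^4) $ 4 = x4"
  unfolding vector_def by simp_all

lemma det_vector_4_scale:
  fixes x1 :: "real^4"
  shows "det (vector [x1, x2, r *\<^sub>R x3, x4] :: real^4^4) = r * det (vector [x1, x2, x3, x4] :: real^4^4)"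
    and "det (vector [x1, x2, x3, r *\<^sub>R x4] :: real^4^4) = r * det (vector [x1, x2, x3, x4] :: real^4^4)"
proof -
  have row: "det (\<chi> i. if i = k then r *s (A $ k) else A $ i) = r * det A" for k and A :: "real^4^4"
  proof -
    have "(\<chi> i. if i = k then A $ k else A $ i) = A" by (simp add: vec_eq_iff)
    then show ?thesis using det_row_mul[of k r "\<lambda>_. A $ k" "($) A"] by simp
  qed
  have "(vector [x1, x2, r *\<^sub>R x3, x4] :: real^4^4) =
      (\<chi> i. if i = 3 then r *s ((vector [x1, x2, x3, x4] :: real^4^4) $ 3) else vector [x1, x2, x3, x4] $ i)"
    by (subst vec_eq_iff, subst forall_4) (simp add: scalar_mult_eq_scaleR)
  then show "det (vector [x1, x2, r *\<^sub>R x3, x4] :: real^4^4) = r * det (vector [x1, x2, x3, x4] :: real^4^4)"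
    using row by simp
  have "(vector [x1, x2, x3, r *\<^sub>R x4] :: real^4^4) =
      (\<chi> i. if i = 4 then r *s ((vector [x1, x2, x3, x4] :: real^4^4) $ 4) else vector [x1, x2, x3, x4] $ i)"
    by (subst vec_eq_iff, subst forall_4) (simp add: scalar_mult_eq_scaleR)
  then show "det (vector [x1, x2, x3, r *\<^sub>R x4] :: real^4^4) = r * det (vector [x1, x2, x3, x4] :: real^4^4)"
    using row by simp
qed

text \<open>The condition inside the definite description \<open>normal_rot\<close>, named so that
  existence and uniqueness can be stated. For Y = 0 the determinant clause is void and the length
  clause forces Z = 0.\<close>

definition is_normal_rot ::
    "(real^4 \<Rightarrow> real^4 \<Rightarrow> real) \<Rightarrow> (complex \<Rightarrow> real^4) \<Rightarrow> real^4 \<Rightarrow> real^4 \<Rightarrow> bool" where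
  "is_normal_rot G L Y Z \<longleftrightarrow> Z \<in> normal_space G L \<and> G Z Y = 0 \<and> G Z Z = G Y Y \<and>
     (Y \<noteq> 0 \<longrightarrow> det (vector [L 1, L \<i>, Y, Z] :: real^4^4) > 0)"

context
  fixes G :: "real^4 \<Rightarrow> real^4 \<Rightarrow> real" and L :: "complex \<Rightarrow> real^4" and \<kappa> :: real
  assumes G: "inner_form G" and L: "linear L"
    and \<kappa>: "\<kappa> > 0" and conf: "\<And>v w. G (L v) (L w) = \<kappa> * (v \<bullet> w)"
begin

lemma is_normal_rot_scale:
  assumes "is_normal_rot G L Y Z" "r > 0"
  shows "is_normal_rot G L (r *\<^sub>R Y) (r *\<^sub>R Z)"
  using assms normal_space_linear(2)[OF G L \<kappa> conf, of Z r]
  by (auto simp: is_normal_rot_def inner_form_simps[OF G] det_vector_4_scale)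

text \<open>Within the normal plane the vectors orthogonal to Y form a line, so W = t Z; equal
  lengths give t * t = 1, and the orientation selects t > 0.\<close>

lemma is_normal_rot_unique:
  assumes Y: "Y \<in> normal_space G L" and Z: "is_normal_rot G L Y Z" "is_normal_rot G L Y W"
  shows "W = Z"
proof (cases "Y = 0")
  case True
  then show ?thesis using Z inner_form_eq_zero_iff[OF G] inner_form_simps(7)[OF G]
    by (simp add: is_normal_rot_def)
next
  case False
  have GZ: "G Z Z = G Y Y" "G W W = G Y Y" "G Y Y \<noteq> 0"
    using Z False inner_form_eq_zero_iff[OF G] by (auto simp: is_normal_rot_def)
  let ?A = "vector [L 1, L \<i>, Y, Z] :: real^4^4"
  \<comment> \<open>The divisor \<open>G Y Y\<close> equals \<open>G Z Z\<close>, so this choice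
    makes \<open>W - t *\<^sub>R Z\<close> orthogonal to Z as well as to the other three
    rows.\<close>
  define t where "t = G Z W / G Y Y"
  have detA: "det ?A > 0" using Z False by (simp add: is_normal_rot_def)
  have N: "G Z (L v) = 0" "G W (L v) = 0" "G Z Y = 0" "G W Y = 0" for v
    using Z by (auto simp: is_normal_rot_def normal_space_def)
  note N' = N[unfolded inner_form_commute[OF G, of Z] inner_form_commute[OF G, of W]]
  have orth: "\<forall>i. G (?A $ i) (W - t *\<^sub>R Z) = 0"
    unfolding forall_4 using N' GZ by (simp add: t_def inner_form_simps[OF G])
  have W: "W = t *\<^sub>R Z"
    using orthogonal_to_frame_eq_zero[OF G, of ?A "W - t *\<^sub>R Z"] detA orth by simp
  then have "t * t = 1" using GZ by (auto simp: inner_form_simps[OF G])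
  moreover have "det (vector [L 1, L \<i>, Y, W] :: real^4^4) > 0"
    using Z False by (simp add: is_normal_rot_def)
  then have "t > 0" using detA W by (simp add: det_vector_4_scale zero_less_mult_iff)
  ultimately have "t = 1" by (metis abs_of_pos real_sqrt_abs2 real_sqrt_one)
  with W show ?thesis by simp
qed

(* Without existence, the THE in normal_rot would be a junk value that need not scale with Y. *)
lemma is_normal_rot_exists:
  assumes Y: "Y \<in> normal_space G L"
  shows "\<exists>Z. is_normal_rot G L Y Z"
proof (cases "Y = 0")
  case True
  then show ?thesis
    by (intro exI[of _ 0]) (simp add: is_normal_rot_def normal_space_def inner_form_simps[OF G])
next
  case False
  \<comment> \<open>Three vectors do not span a space of dimension four, so some nonzero x is
    Euclidean orthogonal to them; the Riesz representation then turns x into a vector orthogonal for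
    G.\<close>
  have "dim {L 1, L \<i>, Y} \<le> card {L 1, L \<i>, Y}" by (rule dim_le_card') simp
  also have "\<dots> \<le> 3" by (simp add: card_insert_if)
  finally have "dim {L 1, L \<i>, Y} < DIM(real^4)" by simp
  then obtain x where x: "x \<noteq> 0" "\<And>y. y \<in> span {L 1, L \<i>, Y} \<Longrightarrow> orthogonal x y"
    by (rule orthogonal_to_subspace_exists) blast
  obtain Z where Z: "\<forall>y. G Z y = x \<bullet> y"
    using inner_form_riesz[OF G bounded_linear.linear[OF bounded_linear_inner_right]] by blast
  have N: "G Z (L 1) = 0" "G Z (L \<i>) = 0" "G Z Y = 0"
    using Z x(2) by (simp_all add: span_base orthogonal_def)
  have nz: "L 1 \<noteq> 0" "L \<i> \<noteq> 0" "Z \<noteq> 0" "Y \<noteq> 0"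
    using conf[of 1 1] conf[of \<i> \<i>] \<kappa> Z[rule_format, of x] x(1) False inner_form_simps(7)[OF G]
    by auto
  have NY: "G Y (L v) = 0" for v using Y by (simp add: normal_space_def)
  define A where "A = (vector [L 1, L \<i>, Y, Z] :: real^4^4)"
  have "\<forall>i j. i \<noteq> j \<longrightarrow> G (A $ i) (A $ j) = 0"
    unfolding forall_4 A_def using N NY conf
      N[unfolded inner_form_commute[OF G, of Z]] NY[unfolded inner_form_commute[OF G, of Y]] by simp
  moreover have "\<forall>i. A $ i \<noteq> 0" unfolding forall_4 A_def using nz by simp
  ultimately have det: "det A \<noteq> 0" by (intro orthogonal_frame_det_nonzero[OF G]) auto
  \<comment> \<open>The square root adjusts the length to that of Y, the sign of the determinant
    adjusts the orientation.\<close>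
  define r where "r = sgn (det A) * sqrt (G Y Y / G Z Z)"
  have pos: "G Y Y > 0" "G Z Z > 0" using G nz by (auto simp: inner_form_def)
  have "G (r *\<^sub>R Z) (r *\<^sub>R Z) = (sgn (det A))\<^sup>2 * (sqrt (G Y Y / G Z Z))\<^sup>2 * G Z Z"
    by (simp add: inner_form_simps[OF G] r_def power2_eq_square mult_ac)
  also have "\<dots> = G Y Y" using pos det by (simp add: sgn_if)
  finally have len: "G (r *\<^sub>R Z) (r *\<^sub>R Z) = G Y Y" .
  have "det (vector [L 1, L \<i>, Y, r *\<^sub>R Z] :: real^4^4) = \<bar>det A\<bar> * sqrt (G Y Y / G Z Z)"
    by (simp add: det_vector_4_scale A_def[symmetric] r_def sgn_if)
  also have "\<dots> > 0" using det pos by simp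
  finally have "is_normal_rot G L Y (r *\<^sub>R Z)"
    using N len by (simp add: is_normal_rot_def normal_space_iff[OF G L \<kappa> conf] inner_form_simps[OF G])
  then show ?thesis by blast
qed

text \<open>A multiple r Z meets the conditions for r Y, because squared lengths and the determinant
  both acquire the factor r * r. Existence provides some Z, and uniqueness identifies both
  descriptions with its multiples.\<close>

lemma normal_rot_scale:
  assumes "Y \<in> normal_space G L" "r > 0"
  shows "normal_rot G L (r *\<^sub>R Y) = r *\<^sub>R normal_rot G L Y"
proof -
  have eq: "normal_rot G L Y = Z" if "Y \<in> normal_space G L" "is_normal_rot G L Y Z" for Y Z
    unfolding normal_rot_def is_normal_rot_def[symmetric]
    using that is_normal_rot_unique by (intro the_equality) blast+
  obtain Z where "is_normal_rot G L Y Z" using is_normal_rot_exists[OF assms(1)] by blast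
  then show ?thesis
    using eq[OF assms(1)] is_normal_rot_scale[OF _ assms(2)]
      eq[OF normal_space_linear(2)[OF G L \<kappa> conf assms(1), of r]] by simp
qed

end

section \<open>Invariance of the normal data under scaling of the inner product\<close>

lemma normal_space_conformal:
  assumes "m \<noteq> 0"
  shows "normal_space (\<lambda>v w. m * G v w) L = normal_space G L"
  using assms by (simp add: normal_space_def)

lemma normal_part_conformal:
  "m \<noteq> 0 \<Longrightarrow> normal_part (\<lambda>v w. m * G v w) L = normal_part G L"
  by (simp add: normal_part_def normal_space_conformal fun_eq_iff)

text \<open>The conditions on G are orthogonality and an equality of squared lengths, both
  indifferent to a nonzero factor; the determinant does not contain G.\<close>

lemma normal_rot_conformal:
  "m \<noteq> 0 \<Longrightarrow> normal_rot (\<lambda>v w. m * G v w) L = normal_rot G L"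
  by (simp add: normal_rot_def normal_space_conformal fun_eq_iff)

lemma isotropic_normal_conformal:
  "m \<noteq> 0 \<Longrightarrow> isotropic_normal s (\<lambda>v w. m * G v w) L = isotropic_normal s G L"
  by (simp add: isotropic_normal_def normal_space_conformal normal_rot_conformal)

section \<open>The Levi-Civita connection under a conformal change\<close>

lemma riemannian_metric_inner_form:
  "riemannian_metric B g \<Longrightarrow> b \<in> B \<Longrightarrow> q \<in> chart_dom b \<Longrightarrow> inner_form (g b q)"
  unfolding riemannian_metric_def inner_form_def by blast

lemma conformal_change_apply:
  "conformal_change \<mu> g b q = (\<lambda>v w. (\<mu> q)\<^sup>2 * g b q v w)"
  by (simp add: conformal_change_def)

lemma conformal_change_inverse:
  assumes "\<And>q. \<mu> q \<noteq> 0"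
  shows "conformal_change (\<lambda>q. inverse (\<mu> q)) (conformal_change \<mu> g) = g"
  using assms by (intro ext) (simp add: conformal_change_def power2_eq_square field_simps)

text \<open>The new metric needs the same standing as the old one: its Koszul formula has to
  determine its Christoffel vector, and the converse implication starts from it.\<close>

lemma riemannian_metric_conformal_change:
  fixes B :: "('m::topological_space, 'e::euclidean_space) chart set"
  assumes at: "smooth_atlas B" and g: "riemannian_metric B g" and \<mu>: "smooth_function B \<mu>" "\<And>q. \<mu> q > 0"
  shows "riemannian_metric B (conformal_change \<mu> g)"
  unfolding riemannian_metric_def
proof (intro conjI ballI allI impI)
  fix b q assume b: "b \<in> B" "q \<in> chart_dom b"
  note inn = riemannian_metric_inner_form[OF g b]
  have "linear (\<lambda>w. (\<mu> q)\<^sup>2 * g b q v w)" "linear (\<lambda>v. (\<mu> q)\<^sup>2 * g b q v w)" for v w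
    by (auto intro!: linearI simp: inner_form_simps[OF inn] algebra_simps)
  then show "bilinear (conformal_change \<mu> g b q)" by (simp add: bilinear_def conformal_change_apply)
  show "conformal_change \<mu> g b q v w = conformal_change \<mu> g b q w v" for v w
    using inner_form_commute[OF inn, of v w] by (simp add: conformal_change_apply)
  show "conformal_change \<mu> g b q v v > 0" if "v \<noteq> 0" for v
    using inn \<mu>(2)[of q] that by (simp add: conformal_change_apply inner_form_def)
next
  fix b v w assume b: "b \<in> B"
  let ?S = "coord b ` chart_dom b"
  have S: "open ?S" using smooth_atlas_chart[OF at b] by (simp add: is_chart_def)
  have m: "smooth_on ?S (\<mu> \<circ> chart_inv b)" using \<mu>(1) b by (simp add: smooth_function_def)
  have "smooth_on ?S (\<lambda>x. g b (chart_inv b x) v w)" using g b unfolding riemannian_metric_def by blast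
  then have "smooth_on ?S (\<lambda>x. (\<mu> \<circ> chart_inv b) x *\<^sub>R ((\<mu> \<circ> chart_inv b) x *\<^sub>R g b (chart_inv b x) v w))"
    by (rule smooth_on_scaleR[OF S m smooth_on_scaleR[OF S m]])
  then show "smooth_on ?S (\<lambda>x. conformal_change \<mu> g b (chart_inv b x) v w)"
    by (simp add: conformal_change_apply power2_eq_square mult.assoc)
next
  fix a b p v w assume "a \<in> B" "b \<in> B" "p \<in> chart_dom a \<inter> chart_dom b"
  then have "g a p v w = g b p (jac a b p v) (jac a b p w)" using g unfolding riemannian_metric_def by blast
  then show "conformal_change \<mu> g a p v w = conformal_change \<mu> g b p (jac a b p v) (jac a b p w)"
    by (simp only: conformal_change_apply)
qed

section \<open>Existence and uniqueness in the Koszul formula\<close>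

context
  fixes B :: "('m::topological_space, 'e::euclidean_space) chart set" and g :: "('m, 'e) metric_field"
  assumes at: "smooth_atlas B" and g: "riemannian_metric B g"
begin

context
  fixes b q
  assumes b: "b \<in> B" and q: "q \<in> chart_dom b"
begin

lemma metric_has_derivative:
  "((\<lambda>x. g b (chart_inv b x) w y) has_derivative (\<lambda>v. metric_deriv g b q v w y)) (at (coord b q))"
proof -
  have "smooth_on (coord b ` chart_dom b) (\<lambda>x. g b (chart_inv b x) w y)"
    using g b unfolding riemannian_metric_def by blast
  from smooth_on_has_derivative[OF this] q show ?thesis unfolding metric_deriv_def by simp
qed

lemma metric_deriv_eqI:
  assumes "(h has_derivative (\<lambda>v. D v)) (at (coord b q))"
    and "\<And>r. r \<in> chart_dom b \<Longrightarrow> h (coord b r) = g b r w y"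
  shows "metric_deriv g b q v w y = D v"
proof -
  have chart: "is_chart b" using smooth_atlas_chart[OF at b] .
  then have "open (coord b ` chart_dom b)" by (simp add: is_chart_def)
  then have "((\<lambda>x. g b (chart_inv b x) w y) has_derivative D) (at (coord b q))"
    by (rule has_derivative_transform_within_open[OF assms(1)])
       (use q assms(2) in \<open>auto simp: chart_inv_coord[OF chart]\<close>)
  from frechet_derivative_at[OF this] show ?thesis by (simp add: metric_deriv_def)
qed

lemma metric_deriv_linear: "linear (\<lambda>v. metric_deriv g b q v w y)"
  using has_derivative_linear[OF metric_has_derivative] .

text \<open>The test vector of the Koszul formula fills the last slot of two terms and the direction
  slot of the third; linearity in these slots makes the right-hand side linear in it. Homogeneity in
  the middle slot enters when an argument of \<open>christoffel\<close> is scaled.\<close>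

lemma metric_deriv_simps:
  "metric_deriv g b q v w (y + y') = metric_deriv g b q v w y + metric_deriv g b q v w y'"
  "metric_deriv g b q v w (r *\<^sub>R y) = r * metric_deriv g b q v w y"
  "metric_deriv g b q v (r *\<^sub>R w) y = r * metric_deriv g b q v w y"
  "metric_deriv g b q (v + v') w y = metric_deriv g b q v w y + metric_deriv g b q v' w y"
  "metric_deriv g b q (r *\<^sub>R v) w y = r * metric_deriv g b q v w y"
proof -
  note inn = riemannian_metric_inner_form[OF g b]
  note inv = chart_inv_coord[OF smooth_atlas_chart[OF at b]]
  show "metric_deriv g b q v w (y + y') = metric_deriv g b q v w y + metric_deriv g b q v w y'"
    by (rule metric_deriv_eqI[OF has_derivative_add[OF metric_has_derivative metric_has_derivative]])
       (simp add: inv inner_form_simps(4)[OF inn])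
  show "metric_deriv g b q v w (r *\<^sub>R y) = r * metric_deriv g b q v w y"
    by (rule metric_deriv_eqI[OF has_derivative_mult_right[OF metric_has_derivative]])
       (simp add: inv inner_form_simps(6)[OF inn])
  show "metric_deriv g b q v (r *\<^sub>R w) y = r * metric_deriv g b q v w y"
    by (rule metric_deriv_eqI[OF has_derivative_mult_right[OF metric_has_derivative]])
       (simp add: inv inner_form_simps(3)[OF inn])
  show "metric_deriv g b q (v + v') w y = metric_deriv g b q v w y + metric_deriv g b q v' w y"
    "metric_deriv g b q (r *\<^sub>R v) w y = r * metric_deriv g b q v w y"
    using linear_add[OF metric_deriv_linear] linear_cmul[OF metric_deriv_linear] by auto
qed

lemma christoffel_eqI:
  assumes "\<And>y. 2 * g b q u y = metric_deriv g b q v w y + metric_deriv g b q w v y - metric_deriv g b q y v w"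
  shows "christoffel g b q v w = u"
  unfolding christoffel_def
proof (rule the_equality)
  fix u' assume u': "\<forall>y. 2 * g b q u' y =
    metric_deriv g b q v w y + metric_deriv g b q w v y - metric_deriv g b q y v w"
  show "u' = u"
  proof (rule inner_form_eqI[OF riemannian_metric_inner_form[OF g b q]])
    show "g b q u' y = g b q u y" for y using u'[rule_format, of y] assms[of y] by linarith
  qed
qed (use assms in auto)

text \<open>The right-hand side is linear in y and hence represented by some vector; only this
  existence makes the definite description \<open>christoffel\<close> satisfy its own defining
  formula.\<close>

lemma christoffel_koszul:
  "2 * g b q (christoffel g b q v w) y =
     metric_deriv g b q v w y + metric_deriv g b q w v y - metric_deriv g b q y v w"
proof -
  define \<phi> where
    "\<phi> y = (metric_deriv g b q v w y + metric_deriv g b q w v y - metric_deriv g b q y v w) / 2" for y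
  have "linear \<phi>"
    by (rule linearI) (simp_all add: \<phi>_def metric_deriv_simps algebra_simps add_divide_distrib diff_divide_distrib)
  then obtain u where u: "\<forall>y. g b q u y = \<phi> y"
    using inner_form_riesz[OF riemannian_metric_inner_form[OF g b q]] by blast
  then have u2: "2 * g b q u y =
      metric_deriv g b q v w y + metric_deriv g b q w v y - metric_deriv g b q y v w" for y
    by (simp only: \<phi>_def) simp
  with christoffel_eqI[OF u2] show ?thesis by simp
qed

lemma christoffel_scaleR: "christoffel g b q v (r *\<^sub>R w) = r *\<^sub>R christoffel g b q v w"
proof (rule christoffel_eqI)
  fix y
  have "2 * g b q (r *\<^sub>R christoffel g b q v w) y = r * (2 * g b q (christoffel g b q v w) y)"
    by (simp add: inner_form_simps[OF riemannian_metric_inner_form[OF g b q]])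
  also have "\<dots> = metric_deriv g b q v (r *\<^sub>R w) y + metric_deriv g b q (r *\<^sub>R w) v y
      - metric_deriv g b q y v (r *\<^sub>R w)"
    unfolding christoffel_koszul by (simp add: metric_deriv_simps algebra_simps)
  finally show "2 * g b q (r *\<^sub>R christoffel g b q v w) y = \<dots>" .
qed

end

end

text \<open>The form \<theta> = d log \<mu> in the chart b, written as a quotient so that no
  logarithm has to be differentiated.\<close>

definition log_deriv :: "('m \<Rightarrow> real) \<Rightarrow> ('m, 'e::euclidean_space) chart \<Rightarrow> 'm \<Rightarrow> 'e \<Rightarrow> real" where
  "log_deriv \<mu> b q v = frechet_derivative (\<mu> \<circ> chart_inv b) (at (coord b q)) v / \<mu> q"

lemma conformal_factor_has_derivative:
  assumes "smooth_function B \<mu>" "\<And>q. \<mu> q > 0" "b \<in> B" "q \<in> chart_dom b"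
  shows "(\<mu> \<circ> chart_inv b has_derivative (\<lambda>v. \<mu> q * log_deriv \<mu> b q v)) (at (coord b q))"
proof -
  have "smooth_on (coord b ` chart_dom b) (\<mu> \<circ> chart_inv b)" using assms by (simp add: smooth_function_def)
  from smooth_on_has_derivative[OF this] assms(4) show ?thesis
    using assms(2)[of q] by (simp add: log_deriv_def)
qed

lemma linear_log_deriv:
  assumes "smooth_function B \<mu>" "\<And>q. \<mu> q > 0" "b \<in> B" "q \<in> chart_dom b"
  shows "linear (log_deriv \<mu> b q)"
proof -
  have "log_deriv \<mu> b q = (\<lambda>v. inverse (\<mu> q) *\<^sub>R (\<mu> q * log_deriv \<mu> b q v))" using assms(2)[of q] by (auto simp: fun_eq_iff)
  moreover have "linear (\<lambda>v. inverse (\<mu> q) *\<^sub>R (\<mu> q * log_deriv \<mu> b q v))"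
    by (rule linear_compose_scale_right[OF has_derivative_linear[OF conformal_factor_has_derivative[OF assms]]])
  ultimately show ?thesis by simp
qed

section \<open>Conformal change of the Christoffel vector\<close>

context
  fixes B :: "('m::topological_space, 'e::euclidean_space) chart set" and g :: "('m, 'e) metric_field"
    and \<mu> :: "'m \<Rightarrow> real" and b q
  assumes at: "smooth_atlas B" and g: "riemannian_metric B g"
    and \<mu>: "smooth_function B \<mu>" and pos: "\<And>q. \<mu> q > 0"
    and b: "b \<in> B" and q: "q \<in> chart_dom b"
begin

text \<open>Leibniz rule for \<mu> * \<mu> * g: each of the two factors contributes \<theta>, hence
  the inner 2.\<close>

lemma metric_deriv_conformal_change:
  "metric_deriv (conformal_change \<mu> g) b q v w y =
     (\<mu> q)\<^sup>2 * (2 * log_deriv \<mu> b q v * g b q w y + metric_deriv g b q v w y)"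
proof -
  note chart = smooth_atlas_chart[OF at b]
  note inv = chart_inv_coord[OF chart]
  note D = has_derivative_mult[OF has_derivative_mult[OF conformal_factor_has_derivative[OF \<mu> pos b q]
      conformal_factor_has_derivative[OF \<mu> pos b q]] metric_has_derivative[OF at g b q]]
  show ?thesis
    by (rule trans[OF metric_deriv_eqI[OF at riemannian_metric_conformal_change[OF at g \<mu> pos] b q D]])
       (auto simp: inv q conformal_change_apply power2_eq_square algebra_simps)
qed

text \<open>The square of \<mu> is common to both sides of the new Koszul formula, and what remains
  beyond the old one are three \<theta> terms, each an inner product with y. One vector N serves all
  v and w, and it enters only with the coefficient \<open>g b q v w\<close>.\<close>

lemma christoffel_conformal_change:
  obtains N where "\<And>v w. christoffel (conformal_change \<mu> g) b q v w =
    christoffel g b q v w + log_deriv \<mu> b q v *\<^sub>R w + log_deriv \<mu> b q w *\<^sub>R v - g b q v w *\<^sub>R N"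
proof -
  note inn = riemannian_metric_inner_form[OF g b q]
  \<comment> \<open>This is the gradient of log \<mu> for g: it turns \<theta>(y) into an inner
    product with y.\<close>
  obtain N where N: "\<And>y. g b q N y = log_deriv \<mu> b q y" using inner_form_riesz[OF inn linear_log_deriv[OF \<mu> pos b q]] by blast
  have "christoffel (conformal_change \<mu> g) b q v w =
    christoffel g b q v w + log_deriv \<mu> b q v *\<^sub>R w + log_deriv \<mu> b q w *\<^sub>R v - g b q v w *\<^sub>R N" for v w
  proof (rule christoffel_eqI[OF at riemannian_metric_conformal_change[OF at g \<mu> pos] b q])
    fix y
    let ?u = "christoffel g b q v w + log_deriv \<mu> b q v *\<^sub>R w + log_deriv \<mu> b q w *\<^sub>R v - g b q v w *\<^sub>R N"
    have "2 * conformal_change \<mu> g b q ?u y = (\<mu> q)\<^sup>2 * (2 * g b q (christoffel g b q v w) y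
        + 2 * log_deriv \<mu> b q v * g b q w y + 2 * log_deriv \<mu> b q w * g b q v y - 2 * log_deriv \<mu> b q y * g b q v w)"
      by (simp add: conformal_change_apply inner_form_simps[OF inn] N algebra_simps)
    also have "\<dots> = metric_deriv (conformal_change \<mu> g) b q v w y
        + metric_deriv (conformal_change \<mu> g) b q w v y - metric_deriv (conformal_change \<mu> g) b q y v w"
      unfolding christoffel_koszul[OF at g b q] metric_deriv_conformal_change
      by (simp add: algebra_simps)
    finally show "2 * conformal_change \<mu> g b q ?u y = \<dots>" .
  qed
  then show ?thesis by (rule that)
qed

end

section \<open>Immersions in complex charts\<close>

lemma re_im_vec_simps [simp]:
  "re_vec (complex_vec X Y) = X" "im_vec (complex_vec X Y) = Y"
  "re_vec (\<xi> + \<eta>) = re_vec \<xi> + re_vec \<eta>" "im_vec (\<xi> + \<eta>) = im_vec \<xi> + im_vec \<eta>"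
  "re_vec (\<xi> - \<eta>) = re_vec \<xi> - re_vec \<eta>" "im_vec (\<xi> - \<eta>) = im_vec \<xi> - im_vec \<eta>"
  "re_vec (r *\<^sub>R \<xi>) = r *\<^sub>R re_vec \<xi>" "im_vec (r *\<^sub>R \<xi>) = r *\<^sub>R im_vec \<xi>"
  by (simp_all add: re_vec_def im_vec_def complex_vec_def vec_eq_iff)

lemma complex_vec_scaleR: "complex_vec (r *\<^sub>R X) (r *\<^sub>R Y) = r *\<^sub>R complex_vec X Y"
  by (simp add: complex_vec_def vec_eq_iff complex_eq_iff)

lemma smult_scaleR: "c *s (r *\<^sub>R \<xi>) = r *\<^sub>R (c *s (\<xi> :: complex^'n))"
  by (simp add: vec_eq_iff)

lemma of_real_smult: "complex_of_real r *s \<xi> = r *\<^sub>R (\<xi> :: complex^'n)"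
  by (simp add: vec_eq_iff scaleR_conv_of_real[where 'a = complex])

text \<open>Homogeneity is demanded only at the real and imaginary parts of \<xi>, since for
  \<open>normal_rot\<close> it is available on the normal space alone.\<close>

lemma complexify_scaleR:
  assumes "T (r *\<^sub>R re_vec \<xi>) = r *\<^sub>R T (re_vec \<xi>)" "T (r *\<^sub>R im_vec \<xi>) = r *\<^sub>R T (im_vec \<xi>)"
  shows "complexify T (r *\<^sub>R \<xi>) = r *\<^sub>R complexify T \<xi>"
  using assms by (simp add: complexify_def complex_vec_scaleR)

lemma pullback_conformal_change:
  "pullback B (conformal_change \<mu> g) F a p v w = (\<mu> (F p))\<^sup>2 * pullback B g F a p v w"
  by (simp add: pullback_def conformal_change_def Let_def)

text \<open>The isothermic condition for the new metric ranges over complex charts of that metric.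
  Dividing their factor \<kappa> by the square of \<mu> gives a factor for the old metric;
  smoothness and orientation do not involve the metric.\<close>

lemma complex_chart_conformal_change:
  assumes "\<And>q. \<mu> q > 0" "complex_chart A (pullback B (conformal_change \<mu> g) F) z"
  shows "complex_chart A (pullback B g F) z"
proof -
  have conf: "\<exists>\<kappa>>0. \<forall>v w. h v w = \<kappa> * (v \<bullet> w)"
    if "\<exists>\<kappa>>0. \<forall>v w. (\<mu> q)\<^sup>2 * h v w = \<kappa> * (v \<bullet> w)" for q and h :: "complex \<Rightarrow> complex \<Rightarrow> real"
  proof -
    obtain \<kappa> where \<kappa>: "\<kappa> > 0" "\<And>v w. (\<mu> q)\<^sup>2 * h v w = \<kappa> * (v \<bullet> w)" using \<open>\<exists>\<kappa>>0. _\<close> by blast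
    have pos: "(\<mu> q)\<^sup>2 > 0" using assms(1)[of q] by simp
    have "h v w = \<kappa> / (\<mu> q)\<^sup>2 * (v \<bullet> w)" for v w
      using \<kappa>(2)[of v w] pos by (simp add: field_simps)
    moreover have "\<kappa> / (\<mu> q)\<^sup>2 > 0" using \<kappa>(1) pos by simp
    ultimately show ?thesis by blast
  qed
  note z = assms(2)[unfolded complex_chart_def Let_def pullback_conformal_change]
  show ?thesis
    unfolding complex_chart_def Let_def
  proof (intro conjI ballI)
    fix a p assume a: "a \<in> A" "p \<in> chart_dom z \<inter> chart_dom a"
    show "Im (cnj (jac z a p 1) * jac z a p \<i>) > 0" using z a by simp
    have "\<exists>\<kappa>>0. \<forall>v w. (\<mu> (F p))\<^sup>2 * pullback B g F a p (jac z a p v) (jac z a p w) = \<kappa> * (v \<bullet> w)"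
      using z a by simp
    then show "\<exists>\<kappa>>0. \<forall>v w. pullback B g F a p (jac z a p v) (jac z a p w) = \<kappa> * (v \<bullet> w)"
      by (rule conf)
  qed (use z in simp_all)
qed

section \<open>Regularity of the immersion in complex charts\<close>

context
  fixes A :: "('n::topological_space, complex) chart set"
    and B :: "('q::topological_space, real^4) chart set"
    and g :: "('q, real^4) metric_field" and F :: "'n \<Rightarrow> 'q" and \<mu> :: "'q \<Rightarrow> real" and z
  assumes surface: "riemann_surface A" and at: "smooth_atlas B" and g: "riemannian_metric B g"
    and F: "smooth_immersion A B F"
    and \<mu>: "smooth_function B \<mu>" and pos: "\<And>q. \<mu> q > 0"
    and z: "complex_chart A (pullback B g F) z"
begin

lemma complex_chart_is_chart: "is_chart z"
  using z by (simp add: complex_chart_def)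

lemma immersion_continuous: "continuous_on UNIV F"
  using F by (simp add: smooth_immersion_def)

lemma open_image_local_dom:
  "b \<in> B \<Longrightarrow> is_chart a \<Longrightarrow> open (coord a ` local_dom a b F)"
  by (intro open_coord_image open_local_dom smooth_atlas_chart[OF at] immersion_continuous)
     (auto simp: local_dom_def)

text \<open>\<open>smooth_immersion\<close> speaks of charts in A, and z is merely compatible with
  them; near each point the expression in z factors through a chart of A.\<close>

lemma smooth_local_rep:
  assumes b: "b \<in> B"
  shows "smooth_on (coord z ` local_dom z b F) (local_rep z b F)"
proof (rule smooth_on_local)
  fix x assume "x \<in> coord z ` local_dom z b F"
  then obtain p where p: "x = coord z p" "p \<in> local_dom z b F" by blast
  obtain a where a: "a \<in> A" "p \<in> chart_dom a" using surface unfolding riemann_surface_def by blast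
  then have ca: "is_chart a" using surface by (simp add: riemann_surface_def)
  let ?U = "local_dom z b F \<inter> chart_dom a"
  have U: "open (coord z ` ?U)"
    using open_local_dom[OF complex_chart_is_chart smooth_atlas_chart[OF at b] immersion_continuous] ca
    by (intro open_coord_image complex_chart_is_chart) (auto simp: is_chart_def local_dom_def)
  have "smooth_on (overlap z a) (transition z a)" using z a by (simp add: complex_chart_def)
  then have "smooth_on (coord z ` ?U) (transition z a)"
    by (rule smooth_on_subset) (auto simp: overlap_def local_dom_def)
  moreover have "smooth_on (coord a ` local_dom a b F) (local_rep a b F)"
    using F a b by (simp add: smooth_immersion_def)
  moreover have "transition z a ` coord z ` ?U \<subseteq> coord a ` local_dom a b F"
    by (auto simp: transition_coord[OF complex_chart_is_chart] local_dom_def)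
  ultimately have "smooth_on (coord z ` ?U) (local_rep a b F \<circ> transition z a)"
    using U by (intro smooth_on_compose)
  then have "smooth_on (coord z ` ?U) (local_rep z b F)"
    by (rule smooth_on_cong[OF _ U])
       (auto simp: local_dom_def transition_coord[OF complex_chart_is_chart] local_rep_coord complex_chart_is_chart ca)
  with U p a show "\<exists>T. open T \<and> x \<in> T \<and> smooth_on T (local_rep z b F)" by blast
qed

lemma smooth_conformal_factor_local:
  assumes b: "b \<in> B"
  shows "smooth_on (coord z ` local_dom z b F) (\<mu> \<circ> F \<circ> chart_inv z)"
proof -
  have "smooth_on (coord b ` chart_dom b) (\<mu> \<circ> chart_inv b)" using \<mu> b by (simp add: smooth_function_def)
  then have "smooth_on (coord z ` local_dom z b F) (\<mu> \<circ> chart_inv b \<circ> local_rep z b F)"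
    by (rule smooth_on_compose[OF smooth_local_rep[OF b] _ open_image_local_dom[OF b complex_chart_is_chart]])
       (auto simp: local_dom_def local_rep_coord[OF complex_chart_is_chart])
  then show ?thesis
    by (rule smooth_on_cong[OF _ open_image_local_dom[OF b complex_chart_is_chart]])
       (auto simp: local_dom_def local_rep_coord[OF complex_chart_is_chart] chart_inv_coord[OF complex_chart_is_chart]
          chart_inv_coord[OF smooth_atlas_chart[OF at b]])
qed

text \<open>The function D lives on the whole domain of z, whereas sections are examined over one
  ambient chart at a time; hence the local statements are glued.\<close>

lemma smooth_conformal_factor: "smooth_on (coord z ` chart_dom z) (\<mu> \<circ> F \<circ> chart_inv z)"
proof (rule smooth_on_local)
  fix x assume "x \<in> coord z ` chart_dom z"
  then obtain p where p: "x = coord z p" "p \<in> chart_dom z" by blast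
  obtain b where b: "b \<in> B" "F p \<in> chart_dom b" using at unfolding smooth_atlas_def by blast
  then have "x \<in> coord z ` local_dom z b F" using p by (auto simp: local_dom_def)
  with smooth_conformal_factor_local[OF b(1)] open_image_local_dom[OF b(1) complex_chart_is_chart]
  show "\<exists>T. open T \<and> x \<in> T \<and> smooth_on T (\<mu> \<circ> F \<circ> chart_inv z)" by blast
qed

section \<open>Effect of the conformal change along the immersion\<close>

context
  fixes b p
  assumes b: "b \<in> B" and p: "p \<in> local_dom z b F"
begin

lemma mem_local_dom: "p \<in> chart_dom z" "F p \<in> chart_dom b"
  using p by (auto simp: local_dom_def)

lemma local_rep_has_derivative:
  "(local_rep z b F has_derivative differential z b F p) (at (coord z p))"
  unfolding differential_def using p by (intro smooth_on_has_derivative[OF smooth_local_rep[OF b]]) simp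

lemma linear_differential: "linear (differential z b F p)"
  using has_derivative_linear[OF local_rep_has_derivative] .

text \<open>A complex chart is conformal for \<open>pullback\<close>, evaluated in a chart a of A.
  The chain rule replaces a by z, and the tensor law of g replaces the ambient chart chosen inside
  \<open>pullback\<close> by b.\<close>

lemma differential_conformal:
  obtains \<kappa> where "\<kappa> > 0"
    "\<And>v w. g b (F p) (differential z b F p v) (differential z b F p w) = \<kappa> * (v \<bullet> w)"
proof -
  obtain a where a: "a \<in> A" "p \<in> chart_dom a" using surface unfolding riemann_surface_def by blast
  then have ca: "is_chart a" using surface by (simp add: riemann_surface_def)
  \<comment> \<open>The same choice as in \<open>pullback\<close>; all that is known of it is that
    it belongs to B and covers F p.\<close>
  define b0 where "b0 = (SOME b. b \<in> B \<and> F p \<in> chart_dom b)"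
  have b0: "b0 \<in> B" "F p \<in> chart_dom b0"
    using someI[of "\<lambda>b. b \<in> B \<and> F p \<in> chart_dom b" b] b mem_local_dom unfolding b0_def by auto
  have Da: "(local_rep a c F has_derivative differential a c F p) (at (coord a p))"
    if "c \<in> B" "F p \<in> chart_dom c" for c
  proof -
    have "smooth_on (coord a ` local_dom a c F) (local_rep a c F)"
      using F a that by (simp add: smooth_immersion_def)
    from smooth_on_has_derivative[OF this] show ?thesis
      unfolding differential_def using a that by (simp add: local_dom_def)
  qed
  have Dza: "(transition z a has_derivative jac z a p) (at (coord z p))"
    using z a mem_local_dom by (intro jac_has_derivative) (auto simp: complex_chart_def)
  have "(local_rep a b F has_derivative differential a b F p) (at (transition z a (coord z p)))"
    using Da[OF b mem_local_dom(2)] by (simp add: transition_coord[OF complex_chart_is_chart mem_local_dom(1)])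
  from diff_chain_at[OF Dza this]
  have L: "differential z b F p = differential a b F p \<circ> jac z a p"
  proof (rule differential_eq[OF _ complex_chart_is_chart, where U = "local_dom z b F \<inter> chart_dom a"])
    show "open (local_dom z b F \<inter> chart_dom a)"
      using open_local_dom[OF complex_chart_is_chart smooth_atlas_chart[OF at b] immersion_continuous] ca
      by (auto simp: is_chart_def)
  qed (use p a in \<open>auto simp: local_dom_def transition_coord[OF complex_chart_is_chart] local_rep_coord[OF ca]\<close>)
  have "(transition b b0 has_derivative jac b b0 (F p)) (at (local_rep a b F (coord a p)))"
    using at b b0 mem_local_dom a
    by (simp add: local_rep_coord[OF ca]) (intro jac_has_derivative, auto simp: smooth_atlas_def)
  from diff_chain_at[OF Da[OF b mem_local_dom(2)] this]
  have L0: "differential a b0 F p = jac b b0 (F p) \<circ> differential a b F p"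
  proof (rule differential_eq[OF _ ca, where U = "local_dom a b F \<inter> local_dom a b0 F"])
    show "open (local_dom a b F \<inter> local_dom a b0 F)"
      using open_local_dom[OF ca smooth_atlas_chart[OF at] immersion_continuous] b b0 by auto
  qed (use mem_local_dom a b0 in \<open>auto simp: local_dom_def local_rep_coord[OF ca]
        transition_coord[OF smooth_atlas_chart[OF at b]]\<close>)
  obtain \<kappa> where \<kappa>: "\<kappa> > 0"
    "\<And>v w. pullback B g F a p (jac z a p v) (jac z a p w) = \<kappa> * (v \<bullet> w)"
    using z a mem_local_dom unfolding complex_chart_def Let_def by blast
  have "g b (F p) (differential z b F p v) (differential z b F p w) = \<kappa> * (v \<bullet> w)" for v w
  proof -
    have tensor: "g b (F p) X Y = g b0 (F p) (jac b b0 (F p) X) (jac b b0 (F p) Y)" for X Y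
      using g b b0 mem_local_dom unfolding riemannian_metric_def by blast
    have "pullback B g F a p X Y = g b (F p) (differential a b F p X) (differential a b F p Y)" for X Y
      by (subst tensor) (simp add: pullback_def b0_def[symmetric] L0)
    with \<kappa>(2)[of v w] show ?thesis by (simp add: L)
  qed
  with \<kappa>(1) show ?thesis by (rule that)
qed

lemma inner_form_along: "inner_form (g b (F p))"
  by (rule riemannian_metric_inner_form[OF g b mem_local_dom(2)])

lemma conformal_factor_square_nonzero: "(\<mu> (F p))\<^sup>2 \<noteq> 0"
  using pos[of "F p"] by simp

text \<open>Normal projection removes the two \<theta> terms, which are tangent. The remaining
  change is a fixed normal vector times v \<bullet> w: it cancels between (1,1) and (\<i>,\<i>) and
  vanishes at (1,\<i>).\<close>

lemma alpha_zz_conformal_change: "alpha_zz (conformal_change \<mu> g) F z b p = alpha_zz g F z b p"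
proof -
  let ?L = "differential z b F p" and ?G = "g b (F p)"
  obtain \<kappa> where \<kappa>: "\<kappa> > 0" "\<And>v w. ?G (?L v) (?L w) = \<kappa> * (v \<bullet> w)" using differential_conformal by blast
  note lin = linear_normal_part[OF inner_form_along linear_differential \<kappa>]
  note tang = normal_part_tangent[OF inner_form_along linear_differential \<kappa>]
  obtain N where N: "\<And>v w. christoffel (conformal_change \<mu> g) b (F p) v w = christoffel g b (F p) v w
      + log_deriv \<mu> b (F p) v *\<^sub>R w + log_deriv \<mu> b (F p) w *\<^sub>R v - ?G v w *\<^sub>R N"
    using christoffel_conformal_change[OF at g \<mu> pos b mem_local_dom(2)] by blast
  have "second_fundamental_form (conformal_change \<mu> g) F z b p v w =
      second_fundamental_form g F z b p v w - (\<kappa> * (v \<bullet> w)) *\<^sub>R normal_part ?G ?L N" for v w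
    unfolding second_fundamental_form_def Let_def conformal_change_apply[where b = b and q = "F p"]
      normal_part_conformal[OF conformal_factor_square_nonzero] N
    by (simp add: linear_add[OF lin] linear_diff[OF lin] linear_cmul[OF lin] tang \<kappa>(2))
  then show ?thesis by (simp add: alpha_zz_def Let_def inner_complex_def)
qed

lemma isotropic_part_conformal_change:
  "isotropic_part s (conformal_change \<mu> g) F z b p = isotropic_part s g F z b p"
  by (simp add: isotropic_part_def alpha_zz_conformal_change conformal_change_apply
      normal_rot_conformal[OF conformal_factor_square_nonzero])

text \<open>The fibre is an eigenspace of the complexified rotation. The rotation commutes with
  positive factors and is common to both metrics.\<close>

lemma isotropic_normal_conformal_change:
  assumes "\<xi> \<in> isotropic_normal s (g b (F p)) (differential z b F p)" "r > 0"
  shows "r *\<^sub>R \<xi> \<in> isotropic_normal s (conformal_change \<mu> g b (F p)) (differential z b F p)"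
proof -
  obtain \<kappa> where \<kappa>: "\<kappa> > 0"
    "\<And>v w. g b (F p) (differential z b F p v) (differential z b F p w) = \<kappa> * (v \<bullet> w)"
    using differential_conformal by blast
  show ?thesis
    using assms normal_rot_scale[OF inner_form_along linear_differential \<kappa> _ assms(2)]
      normal_space_linear(2)[OF inner_form_along linear_differential \<kappa>]
    unfolding conformal_change_apply isotropic_normal_conformal[OF conformal_factor_square_nonzero] isotropic_normal_def
    by (simp add: complexify_scaleR smult_scaleR)
qed

text \<open>Three extra Christoffel terms appear for a normal Y: \<theta>(L v) Y cancels against the
  derivative of 1/\<mu>, \<theta>(Y) L v is tangent and projects to zero, and the gradient term
  carries the coefficient g(L v, Y) = 0.\<close>

lemma normal_deriv_conformal_change:
  assumes sm: "smooth_on (coord z ` local_dom z b F) (\<xi> b \<circ> chart_inv z)"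
    and \<xi>: "re_vec (\<xi> b p) \<in> normal_space (g b (F p)) (differential z b F p)"
      "im_vec (\<xi> b p) \<in> normal_space (g b (F p)) (differential z b F p)"
  shows "normal_deriv (conformal_change \<mu> g) F z b (\<lambda>b p. inverse (\<mu> (F p)) *\<^sub>R \<xi> b p) p v =
    inverse (\<mu> (F p)) *\<^sub>R normal_deriv g F z b \<xi> p v"
proof -
  let ?L = "differential z b F p" and ?G = "g b (F p)" and ?r = "inverse (\<mu> (F p))"
  let ?\<theta> = "log_deriv \<mu> b (F p)"
  let ?D = "frechet_derivative (\<xi> b \<circ> chart_inv z) (at (coord z p))"
  note inv_z = chart_inv_coord[OF complex_chart_is_chart] and inv_b = chart_inv_coord[OF smooth_atlas_chart[OF at b]]
  obtain \<kappa> where \<kappa>: "\<kappa> > 0" "\<And>v w. ?G (?L v) (?L w) = \<kappa> * (v \<bullet> w)" using differential_conformal by blast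
  note lin = linear_normal_part[OF inner_form_along linear_differential \<kappa>]
  note tang = normal_part_tangent[OF inner_form_along linear_differential \<kappa>]
  obtain N where N: "\<And>v w. christoffel (conformal_change \<mu> g) b (F p) v w = christoffel g b (F p) v w
      + ?\<theta> v *\<^sub>R w + ?\<theta> w *\<^sub>R v - ?G v w *\<^sub>R N"
    using christoffel_conformal_change[OF at g \<mu> pos b mem_local_dom(2)] by blast
  have D\<xi>: "(\<xi> b \<circ> chart_inv z has_derivative ?D) (at (coord z p))"
    using p by (intro smooth_on_has_derivative[OF sm]) simp
  have rep: "local_rep z b F (coord z p) = coord b (F p)" by (rule local_rep_coord[OF complex_chart_is_chart mem_local_dom(1)])
  \<comment> \<open>The factor is differentiated through the ambient chart b, because \<theta> is
    expressed in the coordinates of b.\<close>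
  have "(\<mu> \<circ> chart_inv b has_derivative (\<lambda>v. \<mu> (F p) * ?\<theta> v)) (at (local_rep z b F (coord z p)))"
    unfolding rep by (rule conformal_factor_has_derivative[OF \<mu> pos b mem_local_dom(2)])
  from diff_chain_at[OF local_rep_has_derivative this]
  have "(\<mu> \<circ> chart_inv b \<circ> local_rep z b F has_derivative (\<lambda>v. \<mu> (F p) * ?\<theta> (?L v))) (at (coord z p))"
    by (simp add: o_def)
  from Deriv.has_derivative_inverse[OF _ this]
  have "((\<lambda>x. inverse ((\<mu> \<circ> chart_inv b \<circ> local_rep z b F) x)) has_derivative
      (\<lambda>v. - (?r * ?\<theta> (?L v)))) (at (coord z p))"
    using pos[of "F p"] by (simp add: rep inv_b[OF mem_local_dom(2)] mult.assoc[symmetric] mult.commute)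
  from has_derivative_scaleR[OF this D\<xi>]
  have "((\<lambda>x. inverse ((\<mu> \<circ> chart_inv b \<circ> local_rep z b F) x) *\<^sub>R (\<xi> b \<circ> chart_inv z) x) has_derivative
      (\<lambda>v. ?r *\<^sub>R ?D v - (?r * ?\<theta> (?L v)) *\<^sub>R \<xi> b p)) (at (coord z p))"
    by (simp add: rep inv_b[OF mem_local_dom(2)] inv_z[OF mem_local_dom(1)])
  then have "((\<lambda>p. inverse (\<mu> (F p)) *\<^sub>R \<xi> b p) \<circ> chart_inv z has_derivative
      (\<lambda>v. ?r *\<^sub>R ?D v - (?r * ?\<theta> (?L v)) *\<^sub>R \<xi> b p)) (at (coord z p))"
    by (rule has_derivative_transform_within_open[OF _ open_image_local_dom[OF b complex_chart_is_chart]])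
       (use p in \<open>auto simp: local_dom_def local_rep_coord[OF complex_chart_is_chart] inv_z inv_b\<close>)
  note D' = frechet_derivative_at[OF this, symmetric]
  \<comment> \<open>One real computation covers both the real and the imaginary part of the section;
    X stands for the derivative of its components, Y for its value.\<close>
  have *: "normal_part ?G ?L (?r *\<^sub>R X - (?r * ?\<theta> (?L v)) *\<^sub>R Y
      + christoffel (conformal_change \<mu> g) b (F p) (?L v) (?r *\<^sub>R Y)) =
    ?r *\<^sub>R normal_part ?G ?L (X + christoffel g b (F p) (?L v) Y)"
    if "Y \<in> normal_space ?G ?L" for X Y
  proof -
    have "?G (?L v) (?r *\<^sub>R Y) = 0"
      using that by (simp add: normal_space_def inner_form_commute[OF inner_form_along, of "?L v"]
          inner_form_simps[OF inner_form_along])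
    then have "?r *\<^sub>R X - (?r * ?\<theta> (?L v)) *\<^sub>R Y
        + christoffel (conformal_change \<mu> g) b (F p) (?L v) (?r *\<^sub>R Y) =
      ?r *\<^sub>R (X + christoffel g b (F p) (?L v) Y) + ?\<theta> (?r *\<^sub>R Y) *\<^sub>R ?L v"
      unfolding N christoffel_scaleR[OF at g b mem_local_dom(2)] by (simp add: algebra_simps)
    then show ?thesis by (simp only: linear_add[OF lin] linear_cmul[OF lin] tang) simp
  qed
  show ?thesis
    unfolding normal_deriv_def Let_def D' complexify_def re_im_vec_simps
    unfolding conformal_change_apply[where b = b and q = "F p"] normal_part_conformal[OF conformal_factor_square_nonzero]
    using *[OF \<xi>(1)] *[OF \<xi>(2)] by (simp add: complex_vec_scaleR)
qed

end

end

text \<open>Formulated for an arbitrary Riemannian ambient metric, because the converse applies it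
  to \<open>conformal_change \<mu> g\<close>, whose curvature need not be constant.\<close>

lemma isotropically_isothermic_sign_conformal_change:
  fixes A :: "('n::topological_space, complex) chart set"
    and B :: "('q::topological_space, real^4) chart set"
    and g :: "('q, real^4) metric_field" and F :: "'n \<Rightarrow> 'q" and \<mu> :: "'q \<Rightarrow> real"
  assumes surface: "riemann_surface A" and at: "smooth_atlas B" and g: "riemannian_metric B g"
    and F: "smooth_immersion A B F"
    and \<mu>: "smooth_function B \<mu>" and pos: "\<And>q. \<mu> q > 0"
    and iso: "isotropically_isothermic_sign s A (pullback B g F) B g F"
  shows "isotropically_isothermic_sign s A (pullback B (conformal_change \<mu> g) F) B (conformal_change \<mu> g) F"
  unfolding isotropically_isothermic_sign_def
proof (intro allI impI conjI)
  fix z assume "complex_chart A (pullback B (conformal_change \<mu> g) F) z"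
  then have z: "complex_chart A (pullback B g F) z" by (rule complex_chart_conformal_change[OF pos])
  note ctx = surface at g F \<mu> pos z
  note same = isotropic_part_conformal_change[OF ctx]
  show "\<forall>b\<in>B. \<forall>p\<in>local_dom z b F. isotropic_part s (conformal_change \<mu> g) F z b p \<noteq> 0"
    using iso z same unfolding isotropically_isothermic_sign_def by simp
  assume "simply_connected (chart_dom z)"
  with iso z obtain D \<xi> where D: "\<forall>p\<in>chart_dom z. D p > 0"
      "smooth_on (coord z ` chart_dom z) (D \<circ> chart_inv z)"
    and sec: "isotropic_section s B g F z \<xi>" and hol: "holomorphic_section B g F z \<xi>"
    and eq: "\<forall>b\<in>B. \<forall>p\<in>local_dom z b F.
      \<xi> b p \<noteq> 0 \<and> isotropic_part s g F z b p = complex_of_real (D p) *s \<xi> b p"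
    unfolding isotropically_isothermic_sign_def by blast
  have cz: "is_chart z" using z by (simp add: complex_chart_def)
  define D' where "D' p = \<mu> (F p) * D p" for p
  define \<xi>' where "\<xi>' b p = inverse (\<mu> (F p)) *\<^sub>R \<xi> b p" for b p
  have "\<forall>p\<in>chart_dom z. D' p > 0" using D(1) pos by (simp add: D'_def)
  moreover have "smooth_on (coord z ` chart_dom z) (D' \<circ> chart_inv z)"
  proof -
    have "open (coord z ` chart_dom z)" using cz by (simp add: is_chart_def)
    from smooth_on_scaleR[OF this smooth_conformal_factor[OF ctx] D(2)] show ?thesis
      by (simp add: D'_def o_def)
  qed
  moreover have "isotropic_section s B (conformal_change \<mu> g) F z \<xi>'"
    unfolding isotropic_section_def
  proof (intro ballI conjI impI)
    fix b assume b: "b \<in> B"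
    note U = open_image_local_dom[OF ctx b cz]
    have "smooth_on (coord z ` local_dom z b F) (\<xi> b \<circ> chart_inv z)"
      using sec b by (simp add: isotropic_section_def)
    from smooth_on_scaleR[OF U smooth_on_inverse[OF U smooth_conformal_factor_local[OF ctx b]] this]
    show "smooth_on (coord z ` local_dom z b F) (\<xi>' b \<circ> chart_inv z)"
      using pos by (simp add: \<xi>'_def o_def)
    fix p assume p: "p \<in> local_dom z b F"
    have "\<xi> b p \<in> isotropic_normal s (g b (F p)) (differential z b F p)"
      using sec b p by (simp add: isotropic_section_def)
    from isotropic_normal_conformal_change[OF ctx b p this, of "inverse (\<mu> (F p))"] pos
    show "\<xi>' b p \<in> isotropic_normal s (conformal_change \<mu> g b (F p)) (differential z b F p)"
      by (simp add: \<xi>'_def)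
    fix b' assume b': "b' \<in> B" "F p \<in> chart_dom b'"
    \<comment> \<open>Chart compatibility survives the rescaling: the factor depends on p alone, and
      the Jacobian is linear.\<close>
    have "(transition b b' has_derivative jac b b' (F p)) (at (coord b (F p)))"
      using at b b' p by (intro jac_has_derivative) (auto simp: smooth_atlas_def local_dom_def)
    then have "linear (jac b b' (F p))" by (rule has_derivative_linear)
    moreover have "\<xi> b' p = complexify (jac b b' (F p)) (\<xi> b p)"
      using sec b p b' by (simp add: isotropic_section_def)
    ultimately show "\<xi>' b' p = complexify (jac b b' (F p)) (\<xi>' b p)"
      by (simp add: \<xi>'_def complexify_scaleR linear_cmul)
  qed
  moreover have "holomorphic_section B (conformal_change \<mu> g) F z \<xi>'"
    unfolding holomorphic_section_def
  proof (intro ballI)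
    fix b p assume bp: "b \<in> B" "p \<in> local_dom z b F"
    let ?r = "inverse (\<mu> (F p))"
    have "normal_deriv (conformal_change \<mu> g) F z b \<xi>' p v = ?r *\<^sub>R normal_deriv g F z b \<xi> p v" for v
      unfolding \<xi>'_def using sec bp
      by (intro normal_deriv_conformal_change[OF ctx bp]) (simp_all add: isotropic_section_def isotropic_normal_def)
    then have "(1/2) *s (normal_deriv (conformal_change \<mu> g) F z b \<xi>' p 1
        + \<i> *s normal_deriv (conformal_change \<mu> g) F z b \<xi>' p \<i>) =
      ?r *\<^sub>R ((1/2) *s (normal_deriv g F z b \<xi> p 1 + \<i> *s normal_deriv g F z b \<xi> p \<i>))"
      by (simp only: smult_scaleR scaleR_add_right[symmetric])
    also have "\<dots> = 0" using hol bp by (simp only: holomorphic_section_def scaleR_zero_right)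
    finally show "(1/2) *s (normal_deriv (conformal_change \<mu> g) F z b \<xi>' p 1
        + \<i> *s normal_deriv (conformal_change \<mu> g) F z b \<xi>' p \<i>) = 0" .
  qed
  moreover have "\<forall>b\<in>B. \<forall>p\<in>local_dom z b F. \<xi>' b p \<noteq> 0 \<and>
      isotropic_part s (conformal_change \<mu> g) F z b p = complex_of_real (D' p) *s \<xi>' b p"
  proof (intro ballI)
    fix b p assume bp: "b \<in> B" "p \<in> local_dom z b F"
    have "\<mu> (F p) \<noteq> 0" using pos[of "F p"] by simp
    then show "\<xi>' b p \<noteq> 0 \<and>
        isotropic_part s (conformal_change \<mu> g) F z b p = complex_of_real (D' p) *s \<xi>' b p"
      using eq bp same[OF bp, of s] unfolding of_real_smult by (simp add: \<xi>'_def D'_def)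
  qed
  ultimately show "\<exists>D \<xi>. (\<forall>p\<in>chart_dom z. D p > 0) \<and>
             smooth_on (coord z ` chart_dom z) (D \<circ> chart_inv z) \<and>
             isotropic_section s B (conformal_change \<mu> g) F z \<xi> \<and>
             holomorphic_section B (conformal_change \<mu> g) F z \<xi> \<and>
             (\<forall>b\<in>B. \<forall>p\<in>local_dom z b F.
                \<xi> b p \<noteq> 0 \<and>
                isotropic_part s (conformal_change \<mu> g) F z b p = complex_of_real (D p) *s \<xi> b p)"
    by blast
qed

lemma smooth_function_inverse:
  assumes "smooth_atlas B" "smooth_function B \<mu>" "\<And>q. \<mu> q > 0"
  shows "smooth_function B (\<lambda>q. inverse (\<mu> q))"
  unfolding smooth_function_def
proof
  fix b assume b: "b \<in> B"
  have "open (coord b ` chart_dom b)" using smooth_atlas_chart[OF assms(1) b] by (simp add: is_chart_def)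
  moreover have "smooth_on (coord b ` chart_dom b) (\<mu> \<circ> chart_inv b)"
    using assms(2) b by (simp add: smooth_function_def)
  ultimately have "smooth_on (coord b ` chart_dom b) (\<lambda>x. inverse ((\<mu> \<circ> chart_inv b) x))"
    by (rule smooth_on_inverse) (simp add: assms(3))
  then show "smooth_on (coord b ` chart_dom b) ((\<lambda>q. inverse (\<mu> q)) \<circ> chart_inv b)"
    by (simp add: o_def)
qed

theorem proposition28:
  fixes A :: "('n::{t2_space, second_countable_topology}, complex) chart set"
    and B :: "('q::{t2_space, second_countable_topology}, real^4) chart set"
    and g :: "('q, real^4) metric_field"
    and F :: "'n \<Rightarrow> 'q"
    and \<mu> :: "'q \<Rightarrow> real"
    and c :: real
  assumes "riemann_surface A"
    and "space_form4 c B g"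
    and "conformal_immersion A B g F"
    and "smooth_function B \<mu>"
    and "\<forall>q. \<mu> q > 0"
  shows "isotropically_isothermic A (pullback B g F) B g F \<longleftrightarrow>
         isotropically_isothermic A (pullback B (conformal_change \<mu> g) F) B (conformal_change \<mu> g) F"
proof -
  have at: "smooth_atlas B" and g: "riemannian_metric B g"
    using assms(2) by (auto simp: space_form4_def oriented_atlas_def)
  have F: "smooth_immersion A B F" using assms(3) by (simp add: conformal_immersion_def)
  have pos: "\<mu> q > 0" "inverse (\<mu> q) > 0" for q using assms(5) by auto
  note g' = riemannian_metric_conformal_change[OF at g assms(4) pos(1)]
  note \<nu> = smooth_function_inverse[OF at assms(4) pos(1)]
  have inv: "conformal_change (\<lambda>q. inverse (\<mu> q)) (conformal_change \<mu> g) = g"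
    using pos(1) by (intro conformal_change_inverse) (metis less_irrefl)
  \<comment> \<open>Undoing the change by 1/\<mu> returns g exactly, so the second application ends
    at the original condition with the same s.\<close>
  have "isotropically_isothermic_sign s A (pullback B g F) B g F \<longleftrightarrow>
      isotropically_isothermic_sign s A (pullback B (conformal_change \<mu> g) F) B (conformal_change \<mu> g) F" for s
    using isotropically_isothermic_sign_conformal_change[OF assms(1) at g F assms(4) pos(1), of s]
      isotropically_isothermic_sign_conformal_change[OF assms(1) at g' F \<nu> pos(2), of s, unfolded inv]
    by blast
  then show ?thesis by (simp add: isotropically_isothermic_def)
qed

end
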